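(* Let $0<\alpha<1$ and, for $0<\varepsilon<\alpha$, let $T_\varepsilon=\{T_1,T_{1,\varepsilon};p_{1,\varepsilon},p_{2,\varepsilon}\}$ be the position dependent random map described in the context, satisfying conditions (A) and (B) of the context for each $\varepsilon$. Let $f_\varepsilon$ be the unique invariant density of $T_\varepsilon$ and let $f^{\ast}$ be the unique invariant density of the deterministic map $T_1$. If $$\lim_{\varepsilon\to0}\ \sup_{x\in[0,1]}p_{2,\varepsilon}(x)=0,$$ then $$\lim_{\varepsilon\to0}\|f_\varepsilon-f^{\ast}\|_1=0.$$
   Context: Let $I=[0,1]$ with its Borel $\sigma$-algebra $\mathcal{B}(I)$ and Lebesgue measure $m$; $\|\cdot\|_1$ is the norm of $L^1(I,m)$. Let $0<\alpha<1$ and, for $\varepsilon>0$ with $0<\alpha-\varepsilon<1$, define $T_1,T_{1,\varepsilon}:I\to I$ by $$T_1(x)=\begin{cases}x(1+2^{\alpha}x^{\alpha}), & x\in[0,\tfrac12),\\ g_1(x), & x\in[\tfrac12,1],\end{cases}\qquad T_{1,\varepsilon}(x)=\begin{cases}x(1+2^{\alpha-\varepsilon}x^{\alpha-\varepsilon}), & x\in[0,\tfrac12),\\ g_{1,\varepsilon}(x), & x\in[\tfrac12,1],\end{cases}$$ where $g_1,g_{1,\varepsilon}:[\tfrac12,1]\to[0,1]$ are differentiable, vanish at $\tfrac12$, and have derivative $>1$ everywhere (they need not be onto). Let $p_{1,\varepsilon},p_{2,\varepsilon}:I\to[0,1]$ be measurable with $p_{1,\varepsilon}+p_{2,\varepsilon}=1$.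 The position dependent random map $T_\varepsilon=\{T_1,T_{1,\varepsilon};p_{1,\varepsilon},p_{2,\varepsilon}\}$ is the Markov process with transition function $\mathbb{P}_\varepsilon(x,B)=p_{1,\varepsilon}(x)\chi_B(T_1(x))+p_{2,\varepsilon}(x)\chi_B(T_{1,\varepsilon}(x))$, $B\in\mathcal{B}(I)$. A measure $\mu$ is $T_\varepsilon$-invariant if $\mu(B)=\int_{T_1^{-1}(B)}p_{1,\varepsilon}\,d\mu+\int_{T_{1,\varepsilon}^{-1}(B)}p_{2,\varepsilon}\,d\mu$ for all $B\in\mathcal{B}(I)$. An invariant density of $T_\varepsilon$ (respectively of $T_1$) is the density with respect to $m$ of an absolutely continuous $T_\varepsilon$-invariant (respectively $T_1$-invariant) probability measure. For each $\varepsilon$ write $S_1=T_1$, $S_2=T_{1,\varepsilon}$, and let $S_{k,1},S_{k,2}$ be the branches of $S_k$ on $[0,\tfrac12)$ and $[\tfrac12,1]$ respectively. "Decreasing" means non-increasing. Conditions, for each $\varepsilon$: (A) For $k=1,2$ and $l=1,2$, the function $x\mapsto\sum_{i=1}^{l}\dfrac{p_{k,\varepsilon}(S_{k,i}^{-1}(x))}{S_k'(S_{k,i}^{-1}(x))}$ is decreasing on $[0,1)$, where a term is taken to be $0$ when $x$ is not in the image of $S_{k,i}$, and derivatives at the endpoint $\tfrac12$ are one-sided. (B) There is $\delta_\varepsilon>0$ with $\inf_{x\in I}p_{k,\varepsilon}(x)\ge\delta_\varepsilon$ for $k=1,2$. Under these conditions $T_\varepsilon$ has a unique invariant density, and $T_1$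 has a unique invariant density. *)

theory Defs
  imports "HOL-Probability.Probability"
begin

text \<open>Maps of the unit interval are functions \<open>real \<Rightarrow> real\<close>; only their values on \<open>{0..1}\<close> matter.\<close>

abbreviation unit_interval :: "real measure" where
  "unit_interval \<equiv> restrict_space lborel {0..1}"

text \<open>The exponent \<open>a\<close> is \<open>\<alpha>\<close> for the map \<open>T\<^sub>1\<close> and \<open>\<alpha> - \<epsilon>\<close> for its perturbation. At \<open>x = 0\<close> the
  convention \<open>0 powr a = 0\<close> gives the value 0.\<close>

definition intermittent_map :: "real \<Rightarrow> (real \<Rightarrow> real) \<Rightarrow> real \<Rightarrow> real" where
  "intermittent_map a g x = (if x < 1/2 then x * (1 + 2 powr a * x powr a) else g x)"

definition right_branch :: "(real \<Rightarrow> real) \<Rightarrow> bool" where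
  "right_branch g \<longleftrightarrow> g \<in> {1/2..1} \<rightarrow> {0..1} \<and> g (1/2) = 0 \<and>
     (\<forall>x\<in>{1/2..1}. \<exists>D>1. (g has_real_derivative D) (at x within {1/2..1}))"

definition position_probs :: "(real \<Rightarrow> real) \<Rightarrow> (real \<Rightarrow> real) \<Rightarrow> bool" where
  "position_probs p q \<longleftrightarrow> p \<in> borel_measurable unit_interval \<and> q \<in> borel_measurable unit_interval \<and>
     (\<forall>x\<in>{0..1}. p x \<in> {0..1} \<and> q x \<in> {0..1} \<and> p x + q x = 1)"

text \<open>The random map with maps \<open>T\<close>, \<open>S\<close> chosen at \<open>x\<close> with probabilities \<open>p x\<close>, \<open>q x\<close>.\<close>

definition transition ::
    "(real \<Rightarrow> real) \<Rightarrow> (real \<Rightarrow> real) \<Rightarrow> (real \<Rightarrow> real) \<Rightarrow> (real \<Rightarrow> real) \<Rightarrow> real \<Rightarrow> real set \<Rightarrow> ennreal" where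
  "transition T S p q x B =
     ennreal (p x) * indicator B (T x) + ennreal (q x) * indicator B (S x)"

definition random_invariant ::
    "(real \<Rightarrow> real) \<Rightarrow> (real \<Rightarrow> real) \<Rightarrow> (real \<Rightarrow> real) \<Rightarrow> (real \<Rightarrow> real) \<Rightarrow> real measure \<Rightarrow> bool" where
  "random_invariant T S p q \<mu> \<longleftrightarrow> sets \<mu> = sets unit_interval \<and>
     (\<forall>B\<in>sets unit_interval. emeasure \<mu> B =
        (\<integral>\<^sup>+x\<in>T -` B \<inter> {0..1}. ennreal (p x) \<partial>\<mu>) + (\<integral>\<^sup>+x\<in>S -` B \<inter> {0..1}. ennreal (q x) \<partial>\<mu>))"

definition map_invariant :: "(real \<Rightarrow> real) \<Rightarrow> real measure \<Rightarrow> bool" where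
  "map_invariant T \<mu> \<longleftrightarrow> sets \<mu> = sets unit_interval \<and>
     (\<forall>B\<in>sets unit_interval. emeasure \<mu> (T -` B \<inter> {0..1}) = emeasure \<mu> B)"

text \<open>Invariance of a measure under the random map is stationarity for the transition function.\<close>

lemma random_invariant_iff_stationary:
  assumes \<mu>: "sets \<mu> = sets unit_interval"
    and T: "T \<in> unit_interval \<rightarrow>\<^sub>M unit_interval" and S: "S \<in> unit_interval \<rightarrow>\<^sub>M unit_interval"
    and pq: "position_probs p q"
  shows "random_invariant T S p q \<mu> \<longleftrightarrow>
    (\<forall>B\<in>sets unit_interval. emeasure \<mu> B = (\<integral>\<^sup>+x. transition T S p q x B \<partial>\<mu>))"
proof -
  have sp: "space \<mu> = {0..1}"
    using sets_eq_imp_space_eq[OF \<mu>] by (simp add: space_restrict_space)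
  have mp: "p \<in> borel_measurable \<mu>" "q \<in> borel_measurable \<mu>"
    using pq measurable_cong_sets[OF \<mu> refl] unfolding position_probs_def by blast+
  have vim: "R -` B \<inter> {0..1} \<in> sets \<mu>"
    if "R \<in> unit_interval \<rightarrow>\<^sub>M unit_interval" "B \<in> sets unit_interval" for R B
    using measurable_sets[OF that] \<mu> by (simp add: space_restrict_space)
  have "(\<integral>\<^sup>+x. transition T S p q x B \<partial>\<mu>) =
      (\<integral>\<^sup>+x\<in>T -` B \<inter> {0..1}. ennreal (p x) \<partial>\<mu>) + (\<integral>\<^sup>+x\<in>S -` B \<inter> {0..1}. ennreal (q x) \<partial>\<mu>)"
    if B: "B \<in> sets unit_interval" for B
  proof -
    have "(\<integral>\<^sup>+x. transition T S p q x B \<partial>\<mu>) =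
        (\<integral>\<^sup>+x. ennreal (p x) * indicator (T -` B \<inter> {0..1}) x
          + ennreal (q x) * indicator (S -` B \<inter> {0..1}) x \<partial>\<mu>)"
      by (intro nn_integral_cong) (auto simp: transition_def sp indicator_def)
    also have "\<dots> = (\<integral>\<^sup>+x\<in>T -` B \<inter> {0..1}. ennreal (p x) \<partial>\<mu>)
        + (\<integral>\<^sup>+x\<in>S -` B \<inter> {0..1}. ennreal (q x) \<partial>\<mu>)"
      using mp vim[OF T B] vim[OF S B]
      by (intro nn_integral_add borel_measurable_times_ennreal borel_measurable_indicator
            measurable_compose[OF _ measurable_ennreal])
    finally show ?thesis .
  qed
  then show ?thesis
    by (simp add: random_invariant_def \<mu>)
qed

text \<open>\<open>f\<close> is a density of an absolutely continuous probability measure with property \<open>P\<close>. As a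
  representative of an \<open>L\<^sup>1\<close> class it need only be nonnegative almost everywhere.\<close>

definition invariant_density :: "(real measure \<Rightarrow> bool) \<Rightarrow> (real \<Rightarrow> real) \<Rightarrow> bool" where
  "invariant_density P f \<longleftrightarrow> f \<in> borel_measurable unit_interval \<and>
     (AE x in unit_interval. 0 \<le> f x) \<and>
     prob_space (density unit_interval (\<lambda>x. ennreal (f x))) \<and>
     P (density unit_interval (\<lambda>x. ennreal (f x)))"

definition branch_dom :: "nat \<Rightarrow> real set" where
  "branch_dom i = (if i = 1 then {0..<1/2} else {1/2..1})"

text \<open>The summand \<open>p (S\<^sub>i\<^sup>-\<^sup>1 x) / S' (S\<^sub>i\<^sup>-\<^sup>1 x)\<close> for the branch \<open>S\<^sub>i\<close>, zero off its image. The derivative is taken within the branch domain, so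
  it is the ordinary one in the interior and one-sided at the endpoints.\<close>

definition branch_weight :: "(real \<Rightarrow> real) \<Rightarrow> (real \<Rightarrow> real) \<Rightarrow> nat \<Rightarrow> real \<Rightarrow> real" where
  "branch_weight S p i x =
     (if x \<in> S ` branch_dom i
      then let y = the_inv_into (branch_dom i) S x
           in p y / vector_derivative S (at y within branch_dom i)
      else 0)"

definition cond_A ::
    "(real \<Rightarrow> real) \<Rightarrow> (real \<Rightarrow> real) \<Rightarrow> (real \<Rightarrow> real) \<Rightarrow> (real \<Rightarrow> real) \<Rightarrow> bool" where
  "cond_A T S p q \<longleftrightarrow> (\<forall>l\<in>{1, 2}.
     antimono_on {0..<1} (\<lambda>x. \<Sum>i=1..l. branch_weight T p i x) \<and>
     antimono_on {0..<1} (\<lambda>x. \<Sum>i=1..l. branch_weight S q i x))"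

definition cond_B :: "(real \<Rightarrow> real) \<Rightarrow> (real \<Rightarrow> real) \<Rightarrow> bool" where
  "cond_B p q \<longleftrightarrow> (\<exists>\<delta>>0. (INF x\<in>{0..1}. p x) \<ge> \<delta> \<and> (INF x\<in>{0..1}. q x) \<ge> \<delta>)"

end

theory Submission
  imports Defs "HOL-Complex_Analysis.Great_Picard"
begin

text \<open>
  The transfer operator \<open>P\<^sub>\<epsilon>\<close> of the random map is the sum of the Perron-Frobenius operators of the two maps,
  applied to \<open>p\<^sub>1 f\<close> and \<open>p\<^sub>2 f\<close>. It is a contraction of \<open>L\<^sup>1\<close> and differs on densities from the
  operator \<open>P\<close> of the unperturbed map by at most \<open>2 sup p\<^sub>2\<close> (\<open>transfer_perturbation\<close>). Hence
  \<open>P f\<^sub>\<epsilon> - f\<^sub>\<epsilon>\<close> tends to 0 in \<open>L\<^sup>1\<close>, every limit point of the family \<open>f\<^sub>\<epsilon>\<close> is fixed by \<open>P\<close>, and the theorem follows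
  if the family is relatively compact and the fixed density of \<open>P\<close> is unique.

  Compactness comes from monotonicity. Condition A makes the operators preserve decreasing functions
  (\<open>decreasing_profile_map_transfer\<close>). A decreasing fixed density is at most \<open>4 x\<^sup>-\<^sup>\<alpha>\<close>: the mass that a step
  brings into \<open>[0,x]\<close> from the right branch is at most \<open>2 x\<close>, and it has to balance the mass that leaves through
  the interval between \<open>x\<close> and its left preimage, whose length is of order \<open>x\<^sup>1\<^sup>+\<^sup>\<alpha>\<close>
  (\<open>decreasing_profile_bound\<close>). This bound is the same for all \<open>\<epsilon>\<close>, because the perturbed maps expand more
  strongly near 0, and it is integrable. Helly's selection theorem therefore gives convergent
  subsequences in \<open>L\<^sup>1\<close> (\<open>decreasing_profiles_compact\<close>).

  Uniqueness has two parts. Two decreasing fixed densities that are different and have the same integral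
  differ by a function that is positive on some interval and negative on another. Its positive and
  negative parts are fixed as well, so their supports are mapped into themselves by the expanding map;
  intervals grow until they contain \<open>1/2\<close> and then cover a neighbourhood of 0, which contradicts the
  disjointness of the supports (\<open>decreasing_transfer_fixed_unique\<close>). An arbitrary fixed density equals its
  own averages \<open>(f + P f + \<dots> + P\<^sup>n f) / (n + 1)\<close>. By compactness and the first part, the averages of a
  bounded decreasing density converge to the decreasing fixed density, and since such functions span a
  dense subspace of \<open>L\<^sup>1\<close>, so do the averages of every density (\<open>transfer_fixed_unique\<close>). In
  particular every invariant density of the random maps is decreasing up to a null set.

  The same argument covers the unperturbed map, which satisfies condition A as the limit of the
  perturbed ones (\<open>cond_A_unperturbed\<close>).
\<close>

section \<open>The branches of an intermittent map\<close>

definition left_branch :: "real \<Rightarrow> real \<Rightarrow> real" where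
  "left_branch a x = x * (1 + 2 powr a * x powr a)"

text \<open>Expansion is recorded as increments that grow strictly, without a rate. A uniform rate is not
available: the derivative of a right branch exceeds 1 at each point but may come arbitrarily close
to 1, and the left branch has derivative 1 at the neutral fixed point 0.\<close>

definition expanding_on :: "real \<Rightarrow> real \<Rightarrow> (real \<Rightarrow> real) \<Rightarrow> bool" where
  "expanding_on l r \<phi> \<longleftrightarrow> continuous_on {l..r} \<phi> \<and>
     (\<forall>x y. l \<le> x \<longrightarrow> x < y \<longrightarrow> y \<le> r \<longrightarrow> y - x < \<phi> y - \<phi> x) \<and>
     (\<forall>x. l < x \<longrightarrow> x < r \<longrightarrow> (\<exists>D>0. DERIV \<phi> x :> D))"

lemma expanding_onI:
  assumes "continuous_on {l..r} \<phi>" "\<And>x. l < x \<Longrightarrow> x < r \<Longrightarrow> \<exists>D>1. DERIV \<phi> x :> D"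
  shows "expanding_on l r \<phi>"
  unfolding expanding_on_def
proof (intro conjI allI impI)
  fix x y assume xy: "l \<le> x" "x < y" "y \<le> r"
  have "(\<lambda>z. \<phi> z - z) x < (\<lambda>z. \<phi> z - z) y"
  proof (rule DERIV_pos_imp_increasing_open[OF xy(2)])
    show "\<exists>d. DERIV (\<lambda>z. \<phi> z - z) z :> d \<and> d > 0" if z: "x < z" "z < y" for z
    proof -
      obtain D where "D > 1" "DERIV \<phi> z :> D" using assms(2)[of z] xy z by auto
      then have "DERIV (\<lambda>z. \<phi> z - z) z :> D - 1" by (auto intro!: derivative_eq_intros)
      with \<open>D > 1\<close> show ?thesis by auto
    qed
    show "continuous_on {x..y} (\<lambda>z. \<phi> z - z)"
      using xy by (intro continuous_on_diff continuous_on_subset[OF assms(1)] continuous_on_id) auto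
  qed
  then show "y - x < \<phi> y - \<phi> x" by simp
next
  fix x assume "l < x" "x < r"
  then obtain D where "D > 1" "DERIV \<phi> x :> D" using assms(2) by blast
  then show "\<exists>D>0. DERIV \<phi> x :> D" by (intro exI[of _ D]) auto
qed (fact assms)

lemma expanding_on_left_branch:
  assumes "0 < a"
  shows "expanding_on 0 (1/2) (left_branch a)"
proof (rule expanding_onI)
  show "continuous_on {0..1/2} (left_branch a)"
    unfolding left_branch_def using assms by (intro continuous_intros continuous_on_powr') auto
next
  fix x :: real assume x: "0 < x"
  have "DERIV (left_branch a) x :> 1 + (1 + a) * 2 powr a * x powr a"
    unfolding left_branch_def[abs_def] using x
    by (auto intro!: derivative_eq_intros simp: field_simps powr_diff)
  moreover have "1 + (1 + a) * 2 powr a * x powr a > 1" using x assms by simp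
  ultimately show "\<exists>D>1. DERIV (left_branch a) x :> D" by blast
qed

lemma expanding_on_right_branch:
  assumes "right_branch g"
  shows "expanding_on (1/2) 1 g"
proof (rule expanding_onI)
  have d: "\<exists>D>1. (g has_real_derivative D) (at x within {1/2..1})" if "x \<in> {1/2..1}" for x
    using assms that by (auto simp: right_branch_def)
  show "continuous_on {1/2..1} g"
    using d by (meson DERIV_continuous continuous_on_eq_continuous_within)
  show "\<exists>D>1. DERIV g x :> D" if "1/2 < x" "x < 1" for x
    using d[of x] that at_within_Icc_at[of "1/2" x 1] by auto
qed

lemma left_branch_0 [simp]: "left_branch a 0 = 0" and left_branch_half [simp]: "left_branch a (1/2) = 1"
  by (auto simp: left_branch_def powr_divide)

lemma intermittent_map_left: "x < 1/2 \<Longrightarrow> intermittent_map a g x = left_branch a x"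
  and intermittent_map_right: "1/2 \<le> x \<Longrightarrow> intermittent_map a g x = g x"
  by (auto simp: intermittent_map_def left_branch_def)

lemma expanding_on_less: "expanding_on l r \<phi> \<Longrightarrow> l \<le> x \<Longrightarrow> x < y \<Longrightarrow> y \<le> r \<Longrightarrow> y - x < \<phi> y - \<phi> x"
  by (auto simp: expanding_on_def)

text \<open>An open interval is mapped onto the open interval between the images of its end points; this makes
the intervals in the covering argument below computable from their end points.\<close>

lemma expanding_on_image:
  assumes "expanding_on l r \<phi>" "l \<le> a" "a < b" "b \<le> r"
  shows "\<phi> ` {a<..<b} = {\<phi> a<..<\<phi> b}"
proof -
  have mono: "\<phi> x < \<phi> y" if "a \<le> x" "x < y" "y \<le> b" for x y
    using expanding_on_less[OF assms(1), of x y] assms that by auto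
  have "continuous_on {a..b} \<phi>"
    using assms by (auto simp: expanding_on_def intro: continuous_on_subset)
  then have "\<exists>z\<ge>a. z \<le> b \<and> \<phi> z = w" if "\<phi> a < w" "w < \<phi> b" for w
    using IVT'[of \<phi> a w b] that assms by auto
  then have "{\<phi> a<..<\<phi> b} \<subseteq> \<phi> ` {a<..<b}"
    by (smt (verit) greaterThanLessThan_iff image_iff subsetI)
  moreover have "\<phi> ` {a<..<b} \<subseteq> {\<phi> a<..<\<phi> b}"
    using mono by auto
  ultimately show ?thesis by blast
qed

lemma expanding_on_inj: "expanding_on l r \<phi> \<Longrightarrow> inj_on \<phi> {l..r}"
  by (rule linorder_inj_onI) (use expanding_on_less in force)+

text \<open>Each branch is extended continuously to its closed interval, so that the left branch has the value
1 at \<open>1/2\<close>, where the map itself already jumps to 0.\<close>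

definition branch :: "real \<Rightarrow> (real \<Rightarrow> real) \<Rightarrow> nat \<Rightarrow> real \<Rightarrow> real" where
  "branch a g i = (if i = 1 then left_branch a else g)"

definition left_end :: "nat \<Rightarrow> real" where "left_end i = (if i = 1 then 0 else 1/2)"
definition right_end :: "nat \<Rightarrow> real" where "right_end i = (if i = 1 then 1/2 else 1)"

lemma expanding_on_branch:
  "0 < a \<Longrightarrow> right_branch g \<Longrightarrow> expanding_on (left_end i) (right_end i) (branch a g i)"
  using expanding_on_left_branch[of a] expanding_on_right_branch[of g]
  by (auto simp: branch_def left_end_def right_end_def)

lemma intermittent_map_eq_branch:
  "x \<in> branch_dom i \<Longrightarrow> intermittent_map a g x = branch a g i x"
  by (auto simp: branch_dom_def branch_def intermittent_map_left intermittent_map_right split: if_splits)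

lemma branch_range:
  assumes "0 < a" "right_branch g" 
  shows "branch a g i ` {left_end i<..<right_end i} \<subseteq> {0<..<1}"
proof -
  have "branch a g i (left_end i) = 0" "branch a g i (right_end i) \<le> 1" "left_end i < right_end i"
    using assms by (auto simp: branch_def left_end_def right_end_def right_branch_def Pi_iff)
  then show ?thesis
    using expanding_on_image[OF expanding_on_branch[OF assms], of i "left_end i" "right_end i"] by auto
qed

lemma open_subset_branch_dom: "{left_end i<..<right_end i} \<subseteq> branch_dom i"
  and branch_dom_subset: "branch_dom i \<subseteq> {left_end i..right_end i}"
  by (auto simp: branch_dom_def left_end_def right_end_def)

lemma inj_on_intermittent_map:
  assumes "0 < a" "right_branch g"
  shows "inj_on (intermittent_map a g) (branch_dom i)"
  using inj_on_subset[OF expanding_on_inj[OF expanding_on_branch[OF assms, of i]] branch_dom_subset]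
  by (simp cong: inj_on_cong add: intermittent_map_eq_branch)

lemma DERIV_intermittent_map:
  assumes "0 < a" "right_branch g" and y: "y \<in> {left_end i<..<right_end i}"
  shows "DERIV (intermittent_map a g) y :> deriv (intermittent_map a g) y \<and> deriv (intermittent_map a g) y > 0"
proof -
  obtain D where D: "D > 0" "DERIV (branch a g i) y :> D"
    using expanding_on_branch[OF assms(1,2), of i] y by (auto simp: expanding_on_def)
  have "DERIV (intermittent_map a g) y :> D"
    using D(2) y open_subset_branch_dom[of i]
    by (intro has_field_derivative_transform_within_open[OF D(2), of "{left_end i<..<right_end i}"])
       (auto simp: intermittent_map_eq_branch)
  with D(1) show ?thesis using DERIV_imp_deriv by metis
qed

text \<open>In the interior of the branch domain the one-sided derivative is the ordinary one, so the weight
is the summand of the Perron-Frobenius operator.\<close>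

lemma branch_weight_image:
  assumes "0 < a" "right_branch g" and y: "y \<in> {left_end i<..<right_end i}"
  shows "branch_weight (intermittent_map a g) v i (intermittent_map a g y) = v y / deriv (intermittent_map a g) y"
proof -
  let ?T = "intermittent_map a g"
  have yd: "y \<in> branch_dom i" using y open_subset_branch_dom by blast
  have "y \<in> interior (branch_dom i)"
    using y open_subset_branch_dom[of i] by (meson interiorI open_greaterThanLessThan)
  then have "at y within branch_dom i = at y" by (rule at_within_interior)
  then have "vector_derivative ?T (at y within branch_dom i) = deriv ?T y"
    using DERIV_intermittent_map[OF assms] 
    by (metis has_real_derivative_iff_has_vector_derivative vector_derivative_at)
  then show ?thesis
    using yd the_inv_into_f_f[OF inj_on_intermittent_map[OF assms(1,2)] yd] by (auto simp: branch_weight_def)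
qed

text \<open>The end points of the branch domains contribute nothing inside \<open>{0<..<1}\<close>: 0 and \<open>1/2\<close> are sent to 0,
and the possible preimage 1 is discarded by requiring that the function vanishes there.\<close>

lemma branch_weight_eq_0:
  assumes "0 < a" "right_branch g" "v 1 = 0" "0 < x" "x < 1"
    and x: "x \<notin> intermittent_map a g ` {left_end i<..<right_end i}"
  shows "branch_weight (intermittent_map a g) v i x = 0"
proof (cases "x \<in> intermittent_map a g ` branch_dom i")
  case True
  then obtain y where y: "y \<in> branch_dom i" "x = intermittent_map a g y" by auto
  have "y \<notin> {left_end i<..<right_end i}" using x y(2) by blast
  then have "y = 0 \<or> y = 1/2 \<or> y = 1" using y(1)
    by (auto simp: branch_dom_def left_end_def right_end_def split: if_splits)
  moreover have "intermittent_map a g 0 = 0" "intermittent_map a g (1/2) = 0"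
    using assms(2) intermittent_map_right[of "1/2" a g] by (auto simp: intermittent_map_left right_branch_def)
  then have "y \<noteq> 0" "y \<noteq> 1/2" using assms(4) y(2) by (metis less_irrefl)+
  ultimately have "y = 1" by auto
  then show ?thesis
    using True assms(3) y the_inv_into_f_f[OF inj_on_intermittent_map[OF assms(1,2)] y(1)]
    by (auto simp: branch_weight_def Let_def)
qed (auto simp: branch_weight_def)

section \<open>The transfer operator of a single map\<close>

text \<open>Change of variables along one branch: the integrand \<open>\<bar>T' y\<bar> * w (T y)\<close> with \<open>w\<close> the branch weight of \<open>v\<close> is
\<open>v y\<close>. Integrability of \<open>w\<close> is a consequence of this formula and not a premise, so no measurability
of the derivative or of the inverse branch has to be established separately. This is why the
integrals are taken with respect to the completed measure.\<close>

lemma branch_transfer_duality: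
  fixes v :: "real \<Rightarrow> real" and i :: nat
  assumes ag: "0 < a" "right_branch g" and v: "integrable lebesgue v" "v 1 = 0"
    and B: "B \<in> sets borel"
  defines "T \<equiv> intermittent_map a g" and "I \<equiv> {left_end i<..<right_end i}"
  shows "integrable lebesgue (\<lambda>x. indicator {0<..<1} x * branch_weight T v i x)" (is "integrable _ ?F")
    and "(\<integral>x. indicator B x * (indicator {0<..<1} x * branch_weight T v i x) \<partial>lebesgue) =
         (\<integral>y. indicator I y * (indicator B (T y) * v y) \<partial>lebesgue)"
proof -
  have D: "DERIV T y :> deriv T y" "deriv T y > 0" if "y \<in> I" for y
    using DERIV_intermittent_map[OF ag] that by (auto simp: T_def I_def)
  have TI: "T ` I \<subseteq> {0<..<1}"
    using branch_range[OF ag, of i] open_subset_branch_dom[of i]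
    by (auto simp: T_def I_def intermittent_map_eq_branch subset_iff)
  have inj: "inj_on T I"
    unfolding T_def I_def by (rule inj_on_subset[OF inj_on_intermittent_map[OF ag] open_subset_branch_dom])
  have off: "?F x = 0" if "x \<notin> T ` I" for x
    using branch_weight_eq_0[OF ag, of v x i] v(2) that by (auto simp: T_def I_def indicator_def)
  have key: "set_integrable lebesgue (T ` (I \<inter> T -` B)) ?F \<and>
      (LINT x:T ` (I \<inter> T -` B)|lebesgue. ?F x) = (LINT y:(I \<inter> T -` B)|lebesgue. v y)"
    if B: "B \<in> sets borel" for B
  proof -
    let ?S = "I \<inter> T -` B"
    have "continuous_on I T"
      using D(1) by (meson DERIV_isCont continuous_at_imp_continuous_on)
    then have "T \<in> borel_measurable (restrict_space borel I)"
      by (rule borel_measurable_continuous_on_restrict)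
    from measurable_sets[OF this B] have "?S \<in> sets borel"
      by (auto simp: I_def sets_restrict_space_iff space_restrict_space Int_commute)
    then have S: "?S \<in> sets lebesgue" by auto
    have vS: "set_integrable lebesgue ?S v"
      using S v(1) unfolding set_integrable_def by (intro integrable_mult_indicator) auto
    have eq: "\<bar>deriv T y\<bar> * ?F (T y) = v y" if "y \<in> ?S" for y
      using that D(2)[of y] TI branch_weight_image[OF ag, of y i v]
      by (auto simp: T_def I_def indicator_def subset_iff)
    have "(\<lambda>y. \<bar>deriv T y\<bar> * ?F (T y)) absolutely_integrable_on ?S \<and>
        integral ?S (\<lambda>y. \<bar>deriv T y\<bar> * ?F (T y)) = integral ?S v"
    proof
      show "(\<lambda>y. \<bar>deriv T y\<bar> * ?F (T y)) absolutely_integrable_on ?S"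
        using vS eq by (subst set_integrable_cong[OF refl refl, of _ _ v]) auto
      show "integral ?S (\<lambda>y. \<bar>deriv T y\<bar> * ?F (T y)) = integral ?S v"
        using eq by (intro Henstock_Kurzweil_Integration.integral_cong) auto
    qed
    then have "?F absolutely_integrable_on T ` ?S \<and> integral (T ` ?S) ?F = integral ?S v"
      using D(1) inj
      by (subst (asm) has_absolute_integral_change_of_variables_1'[OF S])
         (auto intro: has_field_derivative_at_within inj_on_subset)
    then show ?thesis
      using vS by (auto simp: set_lebesgue_integral_eq_integral)
  qed
  have img: "indicator (T ` (I \<inter> T -` B)) x *\<^sub>R ?F x = indicator B x * ?F x" for B x
    using off[of x] by (auto simp: indicator_def)
  show "integrable lebesgue ?F"
  proof -
    have "(\<lambda>x. indicator (T ` (I \<inter> T -` UNIV)) x *\<^sub>R ?F x) = ?F"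
      unfolding img by simp
    then show ?thesis using key[of UNIV] by (simp only: set_integrable_def) auto
  qed
  have "(\<integral>x. indicator B x * ?F x \<partial>lebesgue) = (LINT y:(I \<inter> T -` B)|lebesgue. v y)"
    using key[OF B] unfolding set_lebesgue_integral_def[of _ "T ` _"] img by simp
  also have "\<dots> = (\<integral>y. indicator I y * (indicator B (T y) * v y) \<partial>lebesgue)"
    unfolding set_lebesgue_integral_def
    by (intro Bochner_Integration.integral_cong) (auto simp: indicator_def)
  finally show "(\<integral>x. indicator B x * ?F x \<partial>lebesgue) = (\<integral>y. indicator I y * (indicator B (T y) * v y) \<partial>lebesgue)" .
qed

text \<open>The Perron-Frobenius operator of \<open>T\<close>, which is the sum of \<open>v y / T' y\<close> over the preimages \<open>y\<close> of \<open>x\<close>. The value 0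
outside the open interval keeps functions supported there; it gives up 0, where they may be
unbounded, and 1, where the weights need not be monotone.\<close>

definition map_transfer :: "(real \<Rightarrow> real) \<Rightarrow> (real \<Rightarrow> real) \<Rightarrow> real \<Rightarrow> real" where
  "map_transfer T v x = (if 0 < x \<and> x < 1 then branch_weight T v 1 x + branch_weight T v 2 x else 0)"

definition vanishes_outside :: "(real \<Rightarrow> real) \<Rightarrow> bool" where
  "vanishes_outside v \<longleftrightarrow> (\<forall>x. x \<le> 0 \<or> 1 \<le> x \<longrightarrow> v x = 0)"

text \<open>The defining property of the Perron-Frobenius operator: integrating the image of \<open>v\<close> over \<open>B\<close> is
integrating \<open>v\<close> over the preimage of \<open>B\<close>.\<close>

lemma map_transfer_duality:
  fixes v :: "real \<Rightarrow> real"
  assumes ag: "0 < a" "right_branch g" and v: "integrable lebesgue v" "vanishes_outside v"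
    and B: "B \<in> sets borel"
  defines "T \<equiv> intermittent_map a g"
  shows "integrable lebesgue (map_transfer T v)"
    and "integrable lebesgue (\<lambda>y. indicator B (T y) * v y)"
    and "(\<integral>x. indicator B x * map_transfer T v x \<partial>lebesgue) = (\<integral>y. indicator B (T y) * v y \<partial>lebesgue)"
proof -
  have v1: "v 1 = 0" using v(2) by (auto simp: vanishes_outside_def)
  let ?F = "\<lambda>i x. indicator {0<..<1} x * branch_weight T v i x"
  let ?G = "\<lambda>i y. indicator {left_end i<..<right_end i} y * (indicator B (T y) * v y)"
  note bt = branch_transfer_duality[OF ag v(1) v1, folded T_def]
  have F: "integrable lebesgue (?F i)" for i using bt(1)[of UNIV] by simp
  have eqF: "map_transfer T v = (\<lambda>x. ?F 1 x + ?F 2 x)"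
    by (auto simp: map_transfer_def indicator_def)
  have v0: "y \<le> 0 \<Longrightarrow> v y = 0" "1 \<le> y \<Longrightarrow> v y = 0" for y
    using v(2) by (auto simp: vanishes_outside_def)
  show "integrable lebesgue (map_transfer T v)"
    unfolding eqF by (intro Bochner_Integration.integrable_add F)
  have G: "integrable lebesgue (?G i)" for i
  proof (rule Bochner_Integration.integrable_bound[OF v(1)])
    have "continuous_on {left_end i<..<right_end i} T"
      using DERIV_intermittent_map[OF ag, of _ i] unfolding T_def
      by (meson DERIV_isCont continuous_at_imp_continuous_on)
    then have "T \<in> borel_measurable (restrict_space borel {left_end i<..<right_end i})"
      by (rule borel_measurable_continuous_on_restrict)
    from measurable_sets[OF this B] have "{left_end i<..<right_end i} \<inter> T -` B \<in> sets borel"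
      by (auto simp: sets_restrict_space_iff space_restrict_space Int_commute)
    then have S: "{left_end i<..<right_end i} \<inter> T -` B \<in> sets lebesgue" by auto
    have "?G i = (\<lambda>y. indicator ({left_end i<..<right_end i} \<inter> T -` B) y * v y)"
      by (auto simp: indicator_def)
    then show "?G i \<in> borel_measurable lebesgue" using S v(1) by simp
  qed (auto simp: indicator_def)
  have ae: "AE y in lebesgue. indicator B (T y) * v y = ?G 1 y + ?G 2 y"
  proof -
    have "AE y::real in lebesgue. y \<noteq> 1/2" 
      using AE_lborel_singleton[of "1/2::real"] by (rule AE_completion)
    then show ?thesis
      by eventually_elim (use v0 in \<open>fastforce simp: indicator_def left_end_def right_end_def not_less\<close>)
  qed
  have GG: "integrable lebesgue (\<lambda>y. ?G 1 y + ?G 2 y)" by (intro Bochner_Integration.integrable_add G)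
  show int: "integrable lebesgue (\<lambda>y. indicator B (T y) * v y)"
    using GG by (rule integrable_cong_AE_imp)
       (use ae in \<open>auto intro!: borel_measurable_AE[OF borel_measurable_integrable[OF GG]] elim: AE_mp\<close>)
  have Bl: "B \<in> sets lebesgue" using B by auto
  have BF: "integrable lebesgue (\<lambda>x. indicator B x * ?F i x)" for i
    using integrable_mult_indicator[OF Bl F[of i]] by simp
  have "(\<integral>x. indicator B x * map_transfer T v x \<partial>lebesgue) =
      (\<integral>x. indicator B x * ?F 1 x + indicator B x * ?F 2 x \<partial>lebesgue)"
    unfolding eqF by (simp add: algebra_simps)
  also have "\<dots> = (\<integral>y. ?G 1 y \<partial>lebesgue) + (\<integral>y. ?G 2 y \<partial>lebesgue)"
    using Bochner_Integration.integral_add[OF BF[of 1] BF[of 2]] bt(2)[OF B] by simp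
  also have "\<dots> = (\<integral>y. ?G 1 y + ?G 2 y \<partial>lebesgue)"
    using Bochner_Integration.integral_add[OF G[of 1] G[of 2]] by simp
  also have "\<dots> = (\<integral>y. indicator B (T y) * v y \<partial>lebesgue)"
    by (rule integral_cong_AE[symmetric]) (use ae int GG in auto)
  finally show "(\<integral>x. indicator B x * map_transfer T v x \<partial>lebesgue) = (\<integral>y. indicator B (T y) * v y \<partial>lebesgue)" .
qed

section \<open>Integrable functions supported in the unit interval\<close>

definition unit_L1 :: "(real \<Rightarrow> real) \<Rightarrow> bool" where
  "unit_L1 u \<longleftrightarrow> integrable lebesgue u \<and> vanishes_outside u"

lemma unit_L1_integrable [simp, intro]: "unit_L1 u \<Longrightarrow> integrable lebesgue u"
  by (simp add: unit_L1_def)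

lemma unit_L1_vanishes: "unit_L1 u \<Longrightarrow> x \<le> 0 \<or> 1 \<le> x \<Longrightarrow> u x = 0"
  by (auto simp: unit_L1_def vanishes_outside_def)

lemma unit_L1_add [intro]: "unit_L1 u \<Longrightarrow> unit_L1 v \<Longrightarrow> unit_L1 (\<lambda>x. u x + v x)"
  and unit_L1_diff [intro]: "unit_L1 u \<Longrightarrow> unit_L1 v \<Longrightarrow> unit_L1 (\<lambda>x. u x - v x)"
  and unit_L1_scale [intro]: "unit_L1 u \<Longrightarrow> unit_L1 (\<lambda>x. c * u x)"
  and unit_L1_abs [intro]: "unit_L1 u \<Longrightarrow> unit_L1 (\<lambda>x. \<bar>u x\<bar>)"
  and unit_L1_pos_part [intro]: "unit_L1 u \<Longrightarrow> unit_L1 (\<lambda>x. max 0 (u x))"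
  and unit_L1_0 [intro]: "unit_L1 (\<lambda>x. 0)"
  by (auto simp: unit_L1_def vanishes_outside_def)

lemma unit_L1_sum [intro]: "(\<And>k. k \<in> K \<Longrightarrow> unit_L1 (u k)) \<Longrightarrow> unit_L1 (\<lambda>x. \<Sum>k\<in>K. u k x)"
  by (induction K rule: infinite_finite_induct) auto

lemma unit_L1_mult:
  assumes u: "unit_L1 u" and p: "p \<in> borel_measurable unit_interval" "\<And>x. x \<in> {0..1} \<Longrightarrow> 0 \<le> p x \<and> p x \<le> 1"
  shows "unit_L1 (\<lambda>x. p x * u x)"
proof -
  have "(\<lambda>x. indicator {0..1} x * p x) \<in> borel_measurable lborel"
    using p(1) borel_measurable_restrict_space_iff[of "{0..1}" lborel p] by (simp add: mult.commute)
  then have m: "(\<lambda>x. indicator {0..1} x * p x) \<in> borel_measurable lebesgue"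
    by (rule measurable_completion)
  have eq: "(\<lambda>x. p x * u x) = (\<lambda>x. (indicator {0..1} x * p x) * u x)"
  proof
    show "p x * u x = (indicator {0..1} x * p x) * u x" for x
      using unit_L1_vanishes[OF u, of x] by (cases "x \<in> {0..1}") auto
  qed
  have "integrable lebesgue (\<lambda>x. p x * u x)"
  proof (rule Bochner_Integration.integrable_bound[of _ u])
    show "(\<lambda>x. p x * u x) \<in> borel_measurable lebesgue"
      unfolding eq by (rule borel_measurable_times[OF m]) (use u in \<open>auto simp: unit_L1_def\<close>)
    have "\<bar>p x * u x\<bar> \<le> \<bar>u x\<bar>" for x
    proof (cases "x \<in> {0..1}")
      case True
      then show ?thesis using p(2)[of x] by (simp add: abs_mult mult_left_le_one_le)
    qed (use unit_L1_vanishes[OF u, of x] in auto)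
    then show "AE x in lebesgue. norm (p x * u x) \<le> norm (u x)" by simp
  qed (use u in auto)
  then show ?thesis using u by (auto simp: unit_L1_def vanishes_outside_def)
qed

lemma branch_weight_add: "branch_weight T (\<lambda>y. u y + v y) i x = branch_weight T u i x + branch_weight T v i x"
  and branch_weight_scale: "branch_weight T (\<lambda>y. c * u y) i x = c * branch_weight T u i x"
  by (auto simp: branch_weight_def Let_def add_divide_distrib)

lemma map_transfer_add: "map_transfer T (\<lambda>y. u y + v y) x = map_transfer T u x + map_transfer T v x"
  and map_transfer_scale: "map_transfer T (\<lambda>y. c * u y) x = c * map_transfer T u x"
  by (auto simp: map_transfer_def branch_weight_add branch_weight_scale algebra_simps)

lemma map_transfer_diff: "map_transfer T (\<lambda>y. u y - v y) x = map_transfer T u x - map_transfer T v x"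
  using map_transfer_add[of T u "\<lambda>y. - 1 * v y" x] map_transfer_scale[of T "-1" v x] by simp

lemma branch_weight_nonneg:
  assumes ag: "0 < a" "right_branch g" and v: "\<And>x. 0 \<le> v x" "v 1 = 0" and x: "0 < x" "x < 1"
  shows "0 \<le> branch_weight (intermittent_map a g) v i x"
proof (cases "x \<in> intermittent_map a g ` {left_end i<..<right_end i}")
  case True
  then obtain y where "y \<in> {left_end i<..<right_end i}" "x = intermittent_map a g y" by blast
  then show ?thesis
    using branch_weight_image[OF ag, of y i v] DERIV_intermittent_map[OF ag, of y i] v(1)[of y] by auto
next
  case False
  then show ?thesis using branch_weight_eq_0[OF ag, of v x i] v x by simp
qed

lemma map_transfer_nonneg:
  assumes "0 < a" "right_branch g" "\<And>x. 0 \<le> v x" "v 1 = 0"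
  shows "0 \<le> map_transfer (intermittent_map a g) v x"
  using branch_weight_nonneg[of a g v x] assms by (simp add: map_transfer_def)

lemma unit_L1_map_transfer:
  "0 < a \<Longrightarrow> right_branch g \<Longrightarrow> unit_L1 v \<Longrightarrow> unit_L1 (map_transfer (intermittent_map a g) v)"
  using map_transfer_duality(1)[of a g v UNIV] by (auto simp: unit_L1_def vanishes_outside_def map_transfer_def)

section \<open>Decreasing functions are preserved\<close>

text \<open>Only the values in \<open>{0<..<1}\<close> carry information, and the function may blow up at 0. Vanishing from 1 on
is compatible with monotonicity because the function is nonnegative.\<close>

definition decreasing_profile :: "(real \<Rightarrow> real) \<Rightarrow> bool" where
  "decreasing_profile f \<longleftrightarrow> (\<forall>x. 0 \<le> f x) \<and> (\<forall>x y. 0 < x \<longrightarrow> x \<le> y \<longrightarrow> f y \<le> f x) \<and> vanishes_outside f"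

lemma intermittent_map_image:
  assumes ag: "0 < a" "right_branch g"
  shows "intermittent_map a g ` {left_end i<..<right_end i} = {0<..<branch a g i (right_end i)}"
proof -
  have "intermittent_map a g ` {left_end i<..<right_end i} = branch a g i ` {left_end i<..<right_end i}"
    using open_subset_branch_dom[of i] by (intro image_cong) (auto simp: intermittent_map_eq_branch)
  also have "\<dots> = {branch a g i (left_end i)<..<branch a g i (right_end i)}"
    by (intro expanding_on_image[OF expanding_on_branch[OF ag]]) (auto simp: left_end_def right_end_def)
  also have "branch a g i (left_end i) = 0"
    using ag by (auto simp: branch_def left_end_def right_branch_def)
  finally show ?thesis .
qed

lemma intermittent_map_strict_mono:
  assumes ag: "0 < a" "right_branch g" and "x \<in> {left_end i<..<right_end i}" "y \<in> {left_end i<..<right_end i}"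
    "intermittent_map a g x < intermittent_map a g y"
  shows "x < y"
proof (rule ccontr)
  assume "\<not> x < y"
  then have "branch a g i y \<le> branch a g i x"
    using expanding_on_less[OF expanding_on_branch[OF ag, of i], of y x] assms by (cases "y = x") auto
  moreover have "x \<in> branch_dom i" "y \<in> branch_dom i"
    using assms open_subset_branch_dom[of i] by blast+
  ultimately show False
    using assms(5) by (simp add: intermittent_map_eq_branch)
qed

text \<open>For \<open>x < x'\<close> with preimages \<open>y < y'\<close> on the left and \<open>z < z'\<close> on the right, \<open>y' < z'\<close> gives
\<open>f y' \<ge> f z'\<close>, and summation by parts turns the monotonicity of the two partial sums of weights into
monotonicity of the weighted sum of values of \<open>f\<close>. The weights on the right branch need not be monotone
by themselves.\<close>

lemma decreasing_profile_map_transfer: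
  assumes ag: "0 < a" "right_branch g" and p: "\<And>x. x \<in> {0..1} \<Longrightarrow> 0 \<le> p x"
    and A: "\<And>l. l \<in> {1,2} \<Longrightarrow> antimono_on {0..<1} (\<lambda>x. \<Sum>i=1..l. branch_weight (intermittent_map a g) p i x)"
    and f: "decreasing_profile f"
  shows "decreasing_profile (map_transfer (intermittent_map a g) (\<lambda>y. p y * f y))"
proof -
  let ?T = "intermittent_map a g" and ?v = "\<lambda>y. p y * f y"
  let ?w = "branch_weight ?T p"
  have f0: "0 \<le> f x" "x \<le> 0 \<or> 1 \<le> x \<Longrightarrow> f x = 0" for x
    using f by (auto simp: decreasing_profile_def vanishes_outside_def)
  have fd: "f y \<le> f x" if "0 < x" "x \<le> y" for x y
    using f that by (auto simp: decreasing_profile_def)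
  have v0: "0 \<le> ?v x" "?v 1 = 0" for x
    using f0[of x] f0[of 1] p[of x] by (cases "x \<in> {0..1}"; auto)+
  have main: "map_transfer ?T ?v x' \<le> map_transfer ?T ?v x" if x: "0 < x" "x < x'" "x' < 1" for x x'
  proof -
    have W: "branch_weight ?T ?v i (?T y) = ?w i (?T y) * f y \<and> 0 \<le> ?w i (?T y)"
      if "y \<in> {left_end i<..<right_end i}" for i y
      using branch_weight_image[OF ag that] DERIV_intermittent_map[OF ag that] p[of y] that
      by (auto simp: left_end_def right_end_def split: if_splits)
    have w1: "?w 1 x' \<le> ?w 1 x"
      using A[of 1] x by (auto simp: monotone_on_def)
    have w12: "?w 1 x' + ?w 2 x' \<le> ?w 1 x + ?w 2 x"
      using A[of 2] x by (auto simp: monotone_on_def numeral_2_eq_2)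
    have "x \<in> ?T ` {left_end 1<..<right_end 1}" "x' \<in> ?T ` {left_end 1<..<right_end 1}"
      using x intermittent_map_image[OF ag, of 1] by (auto simp: branch_def right_end_def)
    then obtain y y' where y: "y \<in> {left_end 1<..<right_end 1}" "x = ?T y"
        "y' \<in> {left_end 1<..<right_end 1}" "x' = ?T y'" by blast
    have "y < y'" using intermittent_map_strict_mono[OF ag y(1,3)] x y by auto
    then have fy: "f y' \<le> f y" using fd y(1) by (auto simp: left_end_def)
    have w1_nn: "0 \<le> ?w 1 x'" "0 \<le> ?w 1 x" using W y by blast+
    show ?thesis
    proof (cases "x' \<in> ?T ` {left_end 2<..<right_end 2}")
      case True
      then have "x \<in> ?T ` {left_end 2<..<right_end 2}"
        using x intermittent_map_image[OF ag, of 2] by auto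
      with True obtain z z' where z: "z \<in> {left_end 2<..<right_end 2}" "x = ?T z"
        "z' \<in> {left_end 2<..<right_end 2}" "x' = ?T z'" by blast
      have "z < z'" using intermittent_map_strict_mono[OF ag z(1,3)] x z by auto
      then have fz: "f z' \<le> f z" using fd z(1) by (auto simp: left_end_def)
      have fyz: "f z' \<le> f y'" using fd y(3) z(3) by (auto simp: left_end_def right_end_def)
      have w2_nn: "0 \<le> ?w 2 x" using W z by blast
      have "?w 1 x' * f y' + ?w 2 x' * f z' \<le> ?w 1 x * f y' + ?w 2 x * f z'"
      proof -
        (* Summation by parts. *)
        have "0 \<le> (?w 1 x - ?w 1 x') * (f y' - f z') + (?w 1 x + ?w 2 x - ?w 1 x' - ?w 2 x') * f z'"
          using w1 w12 fyz f0(1)[of z'] by (intro add_nonneg_nonneg mult_nonneg_nonneg) auto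
        then show ?thesis by (simp add: algebra_simps)
      qed
      also have "\<dots> \<le> ?w 1 x * f y + ?w 2 x * f z"
        using fy fz w1_nn w2_nn by (intro add_mono mult_left_mono) auto
      finally show ?thesis
        using x W[OF y(1)] W[OF y(3)] W[OF z(1)] W[OF z(3)] y z by (auto simp: map_transfer_def)
    next
      case False
      have "?w 1 x' * f y' \<le> ?w 1 x * f y"
        using w1 fy w1_nn f0(1) by (intro mult_mono) auto
      then show ?thesis
        using x W[OF y(1)] W[OF y(3)] y branch_weight_eq_0[OF ag _ _ _ False, of ?v]
          branch_weight_nonneg[OF ag, of ?v x 2] v0
        by (auto simp: map_transfer_def)
    qed
  qed
  show ?thesis
    unfolding decreasing_profile_def
  proof (intro conjI allI impI)
    show nn: "0 \<le> map_transfer ?T ?v x" for x by (rule map_transfer_nonneg[OF ag]) (use v0 in auto)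
    show "map_transfer ?T ?v y \<le> map_transfer ?T ?v x" if "0 < x" "x \<le> y" for x y
    proof (cases "x = y \<or> 1 \<le> y")
      case True
      then show ?thesis using nn[of x] by (auto simp: map_transfer_def)
    qed (use main that in auto)
  qed (auto simp: vanishes_outside_def map_transfer_def)
qed

section \<open>The transfer operator of the random map\<close>

text \<open>The exponent of the second map is at most that of the first one, so the second map expands at least
as much near 0. The deterministic map \<open>T\<close> is covered as well: \<open>p = 1\<close>, \<open>q = 0\<close> and \<open>S = T\<close>. Hence
\<open>q\<close> has to be allowed to vanish, and positivity is required of \<open>p\<close>.\<close>

locale random_map =
  fixes \<alpha> \<beta> :: real and g g' p q :: "real \<Rightarrow> real"
  assumes exponents: "0 < \<beta>" "\<beta> \<le> \<alpha>" "\<alpha> < 1"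
    and right_branches: "right_branch g" "right_branch g'"
    and probs: "position_probs p q"
    and A: "cond_A (intermittent_map \<alpha> g) (intermittent_map \<beta> g') p q"
    and p_pos: "\<And>x. x \<in> {0..1} \<Longrightarrow> 0 < p x"
begin

abbreviation T where "T \<equiv> intermittent_map \<alpha> g"
abbreviation S where "S \<equiv> intermittent_map \<beta> g'"

definition transfer :: "(real \<Rightarrow> real) \<Rightarrow> real \<Rightarrow> real" where
  "transfer u x = map_transfer T (\<lambda>y. p y * u y) x + map_transfer S (\<lambda>y. q y * u y) x"

lemma alpha_pos: "0 < \<alpha>" using exponents by linarith

lemma pq: "x \<in> {0..1} \<Longrightarrow> 0 \<le> p x \<and> p x \<le> 1 \<and> 0 \<le> q x \<and> q x \<le> 1 \<and> p x + q x = 1"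
  using probs by (auto simp: position_probs_def)

lemma pq_measurable: "p \<in> borel_measurable unit_interval" "q \<in> borel_measurable unit_interval"
  using probs by (simp_all add: position_probs_def)

lemma unit_L1_p:
  assumes "unit_L1 u" shows "unit_L1 (\<lambda>y. p y * u y)"
  by (rule unit_L1_mult[OF assms pq_measurable(1)]) (use pq in blast)

lemma unit_L1_q:
  assumes "unit_L1 u" shows "unit_L1 (\<lambda>y. q y * u y)"
  by (rule unit_L1_mult[OF assms pq_measurable(2)]) (use pq in blast)

lemma unit_L1_transfer [intro]: "unit_L1 u \<Longrightarrow> unit_L1 (transfer u)"
  unfolding transfer_def[abs_def] using exponents right_branches alpha_pos
  by (intro unit_L1_add unit_L1_map_transfer unit_L1_p unit_L1_q)

lemma transfer_add: "transfer (\<lambda>y. u y + v y) x = transfer u x + transfer v x"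
  by (simp add: transfer_def distrib_left map_transfer_add)

lemma transfer_scale: "transfer (\<lambda>y. c * u y) x = c * transfer u x"
  using map_transfer_scale[of T c "\<lambda>y. p y * u y" x] map_transfer_scale[of S c "\<lambda>y. q y * u y" x]
  by (simp add: transfer_def algebra_simps)

lemma transfer_diff: "transfer (\<lambda>y. u y - v y) x = transfer u x - transfer v x"
  by (simp add: transfer_def right_diff_distrib map_transfer_diff)

lemma transfer_nonneg: 
  assumes "\<And>x. 0 \<le> u x" "unit_L1 u" shows "0 \<le> transfer u x"
proof -
  have "0 \<le> p x * u x" "0 \<le> q x * u x" for x
    using assms(1)[of x] unit_L1_vanishes[OF assms(2), of x] pq[of x] by (cases "x \<in> {0..1}"; auto)+
  moreover have "u 1 = 0" using unit_L1_vanishes[OF assms(2), of 1] by simp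
  ultimately show ?thesis
    unfolding transfer_def using exponents right_branches alpha_pos
    by (intro add_nonneg_nonneg map_transfer_nonneg) auto
qed

lemma transfer_mono:
  assumes "\<And>x. u x \<le> v x" "unit_L1 u" "unit_L1 v" shows "transfer u x \<le> transfer v x"
  using transfer_nonneg[of "\<lambda>x. v x - u x" x] assms by (auto simp: transfer_diff)

lemma transfer_abs:
  assumes u: "unit_L1 u" shows "\<bar>transfer u x\<bar> \<le> transfer (\<lambda>x. \<bar>u x\<bar>) x"
proof (rule abs_leI)
  show "transfer u x \<le> transfer (\<lambda>x. \<bar>u x\<bar>) x"
    by (rule transfer_mono[OF _ u unit_L1_abs[OF u]]) simp
  have "transfer (\<lambda>x. -1 * u x) x \<le> transfer (\<lambda>x. \<bar>u x\<bar>) x"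
    by (rule transfer_mono[OF _ unit_L1_scale[OF u] unit_L1_abs[OF u]]) simp
  then show "- transfer u x \<le> transfer (\<lambda>x. \<bar>u x\<bar>) x"
    unfolding transfer_scale by simp
qed

text \<open>One step of the Markov chain, seen on densities.\<close>

lemma transfer_duality:
  assumes u: "unit_L1 u" and B: "B \<in> sets borel"
  shows "integrable lebesgue (\<lambda>y. indicator B (T y) * (p y * u y))"
    and "integrable lebesgue (\<lambda>y. indicator B (S y) * (q y * u y))"
    and "(\<integral>x. indicator B x * transfer u x \<partial>lebesgue) =
      (\<integral>y. indicator B (T y) * (p y * u y) \<partial>lebesgue) + (\<integral>y. indicator B (S y) * (q y * u y) \<partial>lebesgue)"
proof -
  note 1 = map_transfer_duality[OF alpha_pos right_branches(1) _ _ B, of "\<lambda>y. p y * u y"]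
  note 2 = map_transfer_duality[OF exponents(1) right_branches(2) _ _ B, of "\<lambda>y. q y * u y"]
  have pu: "unit_L1 (\<lambda>y. p y * u y)" "unit_L1 (\<lambda>y. q y * u y)" using u unit_L1_p unit_L1_q by auto
  show "integrable lebesgue (\<lambda>y. indicator B (T y) * (p y * u y))"
    "integrable lebesgue (\<lambda>y. indicator B (S y) * (q y * u y))"
    using 1 2 pu by (auto simp: unit_L1_def)
  have Bl: "B \<in> sets lebesgue" using B by auto
  have i: "integrable lebesgue (\<lambda>x. indicator B x * map_transfer T (\<lambda>y. p y * u y) x)"
    "integrable lebesgue (\<lambda>x. indicator B x * map_transfer S (\<lambda>y. q y * u y) x)"
    using integrable_mult_indicator[OF Bl 1(1)] integrable_mult_indicator[OF Bl 2(1)] pu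
    by (simp_all add: unit_L1_def)
  show "(\<integral>x. indicator B x * transfer u x \<partial>lebesgue) =
      (\<integral>y. indicator B (T y) * (p y * u y) \<partial>lebesgue) + (\<integral>y. indicator B (S y) * (q y * u y) \<partial>lebesgue)"
    using Bochner_Integration.integral_add[OF i] 1(3) 2(3) pu
    by (auto simp: transfer_def distrib_left unit_L1_def)
qed

lemma transfer_integral:
  assumes u: "unit_L1 u" shows "(\<integral>x. transfer u x \<partial>lebesgue) = (\<integral>x. u x \<partial>lebesgue)"
proof -
  have "(\<integral>x. transfer u x \<partial>lebesgue) = (\<integral>y. p y * u y \<partial>lebesgue) + (\<integral>y. q y * u y \<partial>lebesgue)"
    using transfer_duality(3)[OF u, of UNIV] by simp
  also have "\<dots> = (\<integral>y. p y * u y + q y * u y \<partial>lebesgue)"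
    using unit_L1_p[OF u] unit_L1_q[OF u] by (subst Bochner_Integration.integral_add) auto
  also have "\<dots> = (\<integral>x. u x \<partial>lebesgue)"
  proof (rule Bochner_Integration.integral_cong[OF refl])
    show "p y * u y + q y * u y = u y" for y
      using pq[of y] unit_L1_vanishes[OF u, of y]
      by (cases "y \<in> {0..1}") (auto simp flip: distrib_right)
  qed
  finally show ?thesis .
qed

lemma transfer_contraction:
  assumes u: "unit_L1 u" shows "(\<integral>x. \<bar>transfer u x\<bar> \<partial>lebesgue) \<le> (\<integral>x. \<bar>u x\<bar> \<partial>lebesgue)"
proof -
  have "(\<integral>x. \<bar>transfer u x\<bar> \<partial>lebesgue) \<le> (\<integral>x. transfer (\<lambda>x. \<bar>u x\<bar>) x \<partial>lebesgue)"
    using u transfer_abs[OF u]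
    by (intro integral_mono unit_L1_integrable integrable_abs unit_L1_transfer unit_L1_abs)
  then show ?thesis using transfer_integral[OF unit_L1_abs[OF u]] by simp
qed

lemma decreasing_profile_transfer:
  assumes f: "decreasing_profile f" shows "decreasing_profile (transfer f)"
proof -
  have A': "antimono_on {0..<1} (\<lambda>x. \<Sum>i=1..l. branch_weight T p i x)"
    "antimono_on {0..<1} (\<lambda>x. \<Sum>i=1..l. branch_weight S q i x)" if "l \<in> {1,2}" for l
    using A that unfolding cond_A_def by blast+
  have "decreasing_profile (map_transfer T (\<lambda>y. p y * f y))"
    by (rule decreasing_profile_map_transfer[OF alpha_pos right_branches(1) _ A'(1) f]) (use pq in blast)
  moreover have "decreasing_profile (map_transfer S (\<lambda>y. q y * f y))"
    by (rule decreasing_profile_map_transfer[OF exponents(1) right_branches(2) _ A'(2) f]) (use pq in blast)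
  ultimately have "decreasing_profile (\<lambda>x. map_transfer T (\<lambda>y. p y * f y) x + map_transfer S (\<lambda>y. q y * f y) x)"
    unfolding decreasing_profile_def vanishes_outside_def by (simp add: add_mono)
  then show ?thesis
    by (simp add: transfer_def[abs_def])
qed

end

section \<open>A uniform bound near the neutral fixed point\<close>

lemma left_branch_mono_exponent:
  assumes "0 < \<beta>" "\<beta> \<le> \<alpha>" "0 \<le> y" "y \<le> 1/2"
  shows "left_branch \<alpha> y \<le> left_branch \<beta> y"
proof -
  have "(2 * y) powr \<alpha> \<le> (2 * y) powr \<beta>" using assms by (intro powr_mono') auto
  then show ?thesis using assms by (auto simp: left_branch_def powr_mult intro!: mult_left_mono)
qed

lemma decreasing_profileD:
  assumes "decreasing_profile f"
  shows "0 \<le> f x" "0 < x \<Longrightarrow> x \<le> y \<Longrightarrow> f y \<le> f x" "x \<le> 0 \<or> 1 \<le> x \<Longrightarrow> f x = 0"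
  using assms by (auto simp: decreasing_profile_def vanishes_outside_def)

lemma integrable_indicator_mult [intro]:
  fixes u :: "real \<Rightarrow> real"
  shows "unit_L1 u \<Longrightarrow> B \<in> sets borel \<Longrightarrow> integrable lebesgue (\<lambda>x. indicator B x * u x)"
  using integrable_mult_indicator[of B lebesgue u] by (auto simp: unit_L1_def)

lemma integral_indicator_interval:
  fixes a b c :: real
  assumes "a \<le> b"
  shows "integrable lebesgue (\<lambda>x. indicator {a<..b} x * c)" "(\<integral>x. indicator {a<..b} x * c \<partial>lebesgue) = (b - a) * c"
    "integrable lebesgue (\<lambda>x. indicator {a..b} x * c)" "(\<integral>x. indicator {a..b} x * c \<partial>lebesgue) = (b - a) * c"
proof -
  have 1: "integrable lebesgue (indicator {a<..b} :: real \<Rightarrow> real)" "integrable lebesgue (indicator {a..b} :: real \<Rightarrow> real)"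
    by (auto simp: integrable_indicator_iff assms)
  then show "integrable lebesgue (\<lambda>x. indicator {a<..b} x * c)" "integrable lebesgue (\<lambda>x. indicator {a..b} x * c)"
    by auto
  show "(\<integral>x. indicator {a<..b} x * c \<partial>lebesgue) = (b - a) * c" "(\<integral>x. indicator {a..b} x * c \<partial>lebesgue) = (b - a) * c"
    using assms by (simp_all add: measure_def)
qed

lemma decreasing_profile_le_2:
  assumes "decreasing_profile f" "unit_L1 f" "(\<integral>x. f x \<partial>lebesgue) = 1" "1/2 \<le> x"
  shows "f x \<le> 2"
proof -
  have "(1/2 - 0) * f (1/2) = (\<integral>x. indicator {0<..1/2::real} x * f (1/2) \<partial>lebesgue)"
    by (rule integral_indicator_interval(2)[symmetric]) simp
  also have "\<dots> \<le> (\<integral>x. f x \<partial>lebesgue)"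
    using assms(2) decreasing_profileD[OF assms(1)]
    by (intro integral_mono integral_indicator_interval) (auto simp: indicator_def)
  finally show ?thesis using assms(3) decreasing_profileD(2)[OF assms(1), of "1/2" x] assms(4) by auto
qed

context random_map
begin

text \<open>The point is that the two maps have the same bound: \<open>S\<close> dominates \<open>T\<close> on the left half, and on
the right half both maps grow at least with slope 1 from the value 0 at \<open>1/2\<close>.\<close>

lemma T_le_imp:
  assumes "z \<in> {0<..<1}" "y \<in> {0<..<1/2}" "T z \<le> T y \<or> S z \<le> T y"
  shows "z \<le> y \<or> 1/2 \<le> z \<and> z \<le> 1/2 + T y"
proof (cases "z < 1/2")
  case True
  have "left_branch \<alpha> z \<le> left_branch \<alpha> y"
    using True assms left_branch_mono_exponent[OF exponents(1,2), of z] by (auto simp: intermittent_map_left)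
  then have "\<not> y < z"
    using expanding_on_less[OF expanding_on_left_branch[OF alpha_pos], of y z] True assms by auto
  then show ?thesis by auto
next
  case False
  have "z - 1/2 \<le> k z" if "right_branch k" for k
  proof -
    have k: "k (1/2) = 0" using that by (simp add: right_branch_def)
    show ?thesis
    proof (cases "1/2 < z")
      case True
      then show ?thesis
        using expanding_on_less[OF expanding_on_right_branch[OF that], of "1/2" z] k assms(1) by auto
    next
      case False
      then have "z = 1/2" using \<open>\<not> z < 1/2\<close> by simp
      then show ?thesis unfolding \<open>z = 1/2\<close> k by simp
    qed
  qed
  then have "z - 1/2 \<le> g z" "z - 1/2 \<le> g' z" using right_branches by auto
  then show ?thesis using assms False by (auto simp: intermittent_map_right)
qed

text \<open>Let \<open>y\<close> be the left preimage of \<open>x\<close> under \<open>T\<close>. Mass that is moved into \<open>{0<..x}\<close> comes from \<open>{0<..y}\<close> or from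
an interval of length \<open>x\<close> to the right of \<open>1/2\<close>, where \<open>f \<le> 2\<close>. The mass of \<open>{0<..y}\<close> cancels, so that the
mass of \<open>{y<..x}\<close> is at most \<open>(2 + c) * x\<close>. This mass is at least \<open>(x - y) * f x\<close>, and \<open>x - y\<close> is of order
\<open>x powr (1 + \<alpha>)\<close>. The bound is uniform in the second exponent and in the probabilities. The
error term \<open>c\<close> makes it applicable to averages of iterates, which are only almost fixed.\<close>

lemma decreasing_profile_bound:
  assumes f: "decreasing_profile f" "unit_L1 f" "(\<integral>x. f x \<partial>lebesgue) = 1"
    and c: "0 \<le> c" and le: "AE x in lebesgue. x \<in> {0<..<1} \<longrightarrow> f x \<le> transfer f x + c"
    and x: "x \<in> {0<..<1}"
  shows "f x \<le> 2 * (2 + c) * x powr - \<alpha>"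
proof -
  have "x \<in> T ` {left_end 1<..<right_end 1}"
    using x intermittent_map_image[OF alpha_pos right_branches(1), of 1] by (auto simp: branch_def right_end_def)
  then obtain y where y: "y \<in> {0<..<1/2}" "x = T y" by (auto simp: left_end_def right_end_def)
  have xy: "x - y = y * (2 * y) powr \<alpha>"
    using y by (simp add: intermittent_map_left left_branch_def powr_mult algebra_simps)
  have pow: "0 < (2 * y) powr \<alpha>" "(2 * y) powr \<alpha> \<le> 1" using y alpha_pos by (auto intro: powr_le1)
  then have "x - y > 0" "x - y \<le> y" unfolding xy using y by (auto simp: mult_left_le)
  then have yx: "y < x" "x \<le> 2 * y" by auto
  note f0 = decreasing_profileD[OF f(1)]
  let ?B = "{0<..x}"
  (* A majorant of the mass that one step moves into ?B. *)
  let ?J = "\<lambda>z. indicator {0<..y} z * f z + indicator {1/2..1/2 + x} z * 2"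
  have I: "integrable lebesgue ?J"
    using f(2) x by (intro Bochner_Integration.integrable_add integrable_indicator_mult integral_indicator_interval) auto
  have le_J: "indicator ?B (T z) * (p z * f z) + indicator ?B (S z) * (q z * f z) \<le> ?J z" for z
  proof (cases "z \<in> {0<..<1}")
    case True
    have pqz: "0 \<le> p z" "0 \<le> q z" "p z + q z = 1" using pq[of z] True by auto
    have pqf: "p z * f z + q z * f z = f z" using pqz(3) by (simp flip: distrib_right)
    have "0 \<le> p z * f z" "0 \<le> q z * f z" using pqz f0(1)[of z] by simp_all
    with pqf have "p z * f z \<le> f z" "q z * f z \<le> f z" by linarith+
    note pqf = pqf this
    have "indicator ?B (T z) * (p z * f z) + indicator ?B (S z) * (q z * f z) \<le>
       (if T z \<le> T y \<or> S z \<le> T y then f z else 0)"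
      using pqf f0(1)[of z] y(2) by (auto simp: indicator_def pqz(3))
    also have "\<dots> \<le> ?J z"
      using T_le_imp[OF True y(1)] f0(1)[of z] pqz True y decreasing_profile_le_2[OF f, of z]
      by (auto simp: indicator_def split: if_splits)
    finally show ?thesis .
  next
    case False
    then have "f z = 0" using f0(3) by (auto simp: not_less)
    then show ?thesis by (simp add: indicator_def)
  qed
  have "(\<integral>z. indicator ?B z * f z \<partial>lebesgue) \<le> (\<integral>z. indicator ?B z * transfer f z + indicator ?B z * c \<partial>lebesgue)"
  proof (rule integral_mono_AE)
    show "AE z in lebesgue. indicator ?B z * f z \<le> indicator ?B z * transfer f z + indicator ?B z * c"
      using le by eventually_elim (use x in \<open>auto simp: indicator_def\<close>)
  qed (use f(2) x in \<open>auto intro!: Bochner_Integration.integrable_add integrable_indicator_mult integral_indicator_interval\<close>)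
  also have "\<dots> = (\<integral>z. indicator ?B z * transfer f z \<partial>lebesgue) + x * c"
    using f(2) x integral_indicator_interval[of 0 x c]
    by (subst Bochner_Integration.integral_add) (auto intro!: integrable_indicator_mult)
  also have "(\<integral>z. indicator ?B z * transfer f z \<partial>lebesgue) =
      (\<integral>z. indicator ?B (T z) * (p z * f z) + indicator ?B (S z) * (q z * f z) \<partial>lebesgue)"
    using transfer_duality[OF f(2), of ?B] by simp
  also have "\<dots> \<le> (\<integral>z. ?J z \<partial>lebesgue)"
    using transfer_duality[OF f(2), of ?B] I le_J by (intro integral_mono) auto
  also have "\<dots> = (\<integral>z. indicator {0<..y} z * f z \<partial>lebesgue) + x * 2"
    using f(2) x integral_indicator_interval[of "1/2" "1/2 + x" 2]
    by (subst Bochner_Integration.integral_add) (auto intro!: integrable_indicator_mult)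
  finally have 1: "(\<integral>z. indicator ?B z * f z \<partial>lebesgue) \<le> (\<integral>z. indicator {0<..y} z * f z \<partial>lebesgue) + x * 2 + x * c"
    by simp
  have "(x - y) * f x + (\<integral>z. indicator {0<..y} z * f z \<partial>lebesgue)
      = (\<integral>z. indicator {y<..x} z * f x + indicator {0<..y} z * f z \<partial>lebesgue)"
    using f(2) yx integral_indicator_interval[of y x "f x"]
    by (subst Bochner_Integration.integral_add) (auto intro!: integrable_indicator_mult)
  also have "\<dots> \<le> (\<integral>z. indicator ?B z * f z \<partial>lebesgue)"
    using f(2) yx y f0(2)
    by (intro integral_mono Bochner_Integration.integrable_add integrable_indicator_mult integral_indicator_interval)
       (auto simp: indicator_def)
  finally have "(x - y) * f x \<le> x * (2 + c)" using 1 by (simp add: algebra_simps)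
  also have "\<dots> \<le> (2 * y) * (2 + c)" using yx c by (intro mult_right_mono) auto
  finally have "y * ((2 * y) powr \<alpha> * f x) \<le> y * (2 * (2 + c))" unfolding xy by (simp add: algebra_simps)
  then have 2: "(2 * y) powr \<alpha> * f x \<le> 2 * (2 + c)" using y by simp
  have "x powr \<alpha> * f x \<le> (2 * y) powr \<alpha> * f x"
    using yx x alpha_pos f0(1) by (intro mult_right_mono powr_mono2) auto
  then have "x powr \<alpha> * f x \<le> 2 * (2 + c)" using 2 by simp
  then show ?thesis using x by (simp add: powr_minus field_simps)
qed

end

section \<open>Compactness of families of decreasing functions\<close>

lemma decreasing_discont_countable:
  fixes H :: "real \<Rightarrow> real"
  assumes "\<And>x y. 0 < x \<Longrightarrow> x \<le> y \<Longrightarrow> H y \<le> H x"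
  shows "countable {x. 0 < x \<and> \<not> isCont H x}"
proof -
  have "mono_on {0<..} (\<lambda>x. - H x)" using assms by (auto simp: monotone_on_def)
  then have "countable {x \<in> {0<..}. \<not> isCont (\<lambda>x. - H x) x}"
    by (intro mono_on_ctble_discont_open) auto
  moreover have "isCont (\<lambda>x. - H x) x = isCont H x" for x
    using isCont_minus[of x H] isCont_minus[of x "\<lambda>x. - H x"] by auto
  ultimately show ?thesis by simp
qed

lemma AE_lebesgue_countable:
  assumes "countable (A :: real set)" shows "AE x in lebesgue. x \<notin> A"
proof -
  have "AE x in lborel. x \<notin> A" using assms by (intro AE_not_in countable_imp_null_set_lborel)
  then show ?thesis by (rule AE_completion)
qed

text \<open>Helly's selection theorem for decreasing functions that may be unbounded at 0. A diagonal sequence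
converges at all positive rationals, and monotonicity carries the convergence over to every
continuity point of the limit.\<close>

theorem decreasing_selection:
  fixes f :: "nat \<Rightarrow> real \<Rightarrow> real"
  assumes mono: "\<And>n x y. 0 < x \<Longrightarrow> x \<le> y \<Longrightarrow> f n y \<le> f n x"
    and bounds: "\<And>n x. 0 < x \<Longrightarrow> 0 \<le> f n x \<and> f n x \<le> K x"
  obtains r H where "strict_mono (r :: nat \<Rightarrow> nat)" "\<And>x. 0 < x \<Longrightarrow> 0 \<le> H x"
    "\<And>x y. 0 < x \<Longrightarrow> x \<le> y \<Longrightarrow> H y \<le> H x"
    "\<And>x. 0 < x \<Longrightarrow> isCont H x \<Longrightarrow> (\<lambda>n. f (r n) x) \<longlonglongrightarrow> H x"
proof -
  let ?Q = "\<rat> \<inter> {0::real<..}"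
  (* Dividing by K x + 1 makes the bound uniform in x, as the diagonal argument requires. *)
  have "countable ?Q" using countable_rat by auto
  moreover have "norm (f n x / (K x + 1)) \<le> 1" if "x \<in> ?Q" for n x
    using bounds[of x n] that by (auto simp: divide_simps)
  ultimately obtain r where r: "strict_mono r" "\<And>x. x \<in> ?Q \<Longrightarrow> \<exists>l. (\<lambda>n. f (r n) x / (K x + 1)) \<longlonglongrightarrow> l"
    using function_convergent_subsequence[of ?Q "\<lambda>n x. f n x / (K x + 1)" 1] by blast
  have "\<exists>l. (\<lambda>n. f (r n) x) \<longlonglongrightarrow> l" if "x \<in> ?Q" for x
  proof -
    obtain l where "(\<lambda>n. f (r n) x / (K x + 1)) \<longlonglongrightarrow> l" using r(2) \<open>x \<in> ?Q\<close> by blast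
    from tendsto_mult_right[OF this, of "K x + 1"] show ?thesis
      using bounds[of x 0] \<open>x \<in> ?Q\<close> by auto
  qed
  then obtain L where L: "\<And>x. x \<in> ?Q \<Longrightarrow> (\<lambda>n. f (r n) x) \<longlonglongrightarrow> L x" by metis
  have L0: "0 \<le> L x" if "x \<in> ?Q" for x
    using LIMSEQ_le_const[OF L[OF that]] bounds[of x] that by auto
  have Lmono: "L y \<le> L x" if "x \<in> ?Q" "y \<in> ?Q" "x \<le> y" for x y
    using LIMSEQ_le[OF L L] mono that by auto
  define H where "H x = Inf (L ` (?Q \<inter> {..<x}))" for x
  have ne: "L ` (?Q \<inter> {..<x}) \<noteq> {}" if "0 < x" for x
    using Rats_dense_in_real[OF that] by auto
  have bdd: "bdd_below (L ` (?Q \<inter> {..<x}))" for x using L0 by (auto intro!: bdd_belowI[of _ 0])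
  have H_le: "H x \<le> L q" if "q \<in> ?Q" "q < x" for q x
    unfolding H_def using that bdd by (intro cInf_lower) auto
  have H_ge: "L q \<le> H x" if "q \<in> ?Q" "0 < x" "x < q" for q x
    unfolding H_def using ne[OF that(2)] Lmono that by (intro cInf_greatest) auto
  show ?thesis
  proof (rule that[OF r(1)])
    show "0 \<le> H x" if "0 < x" for x unfolding H_def using ne[OF that] L0 by (intro cInf_greatest) auto
    show "H y \<le> H x" if "0 < x" "x \<le> y" for x y
      unfolding H_def using ne[OF that(1)] bdd that by (intro cInf_superset_mono) auto
    show "(\<lambda>n. f (r n) x) \<longlonglongrightarrow> H x" if x: "0 < x" "isCont H x" for x
    proof (rule LIMSEQ_I)
      fix e :: real assume e: "0 < e"
      then obtain d where d: "d > 0" "\<And>z. \<bar>z - x\<bar> < d \<Longrightarrow> \<bar>H z - H x\<bar> < e / 2"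
        using x(2) unfolding continuous_at_eps_delta dist_real_def by (meson half_gt_zero)
      define z1 where "z1 = max (x / 2) (x - d / 2)"
      have z1: "0 < z1" "z1 < x" "\<bar>z1 - x\<bar> < d" using d(1) x(1) by (auto simp: z1_def)
      obtain q1 where q1: "q1 \<in> \<rat>" "z1 < q1" "q1 < x" using Rats_dense_in_real[OF z1(2)] by blast
      have "L q1 \<le> H z1" using H_ge[of q1 z1] q1 z1 by auto
      then have L1: "L q1 < H x + e / 2" using d(2)[OF z1(3)] unfolding abs_less_iff by linarith
      define z2 where "z2 = x + d / 2"
      have z2: "x < z2" "\<bar>z2 - x\<bar> < d" using d(1) by (auto simp: z2_def)
      obtain q2 where q2: "q2 \<in> \<rat>" "x < q2" "q2 < z2" using Rats_dense_in_real[OF z2(1)] by blast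
      have "H z2 \<le> L q2" using H_le[of q2 z2] q2 x by auto
      then have L2: "H x - e / 2 < L q2" using d(2)[OF z2(2)] unfolding abs_less_iff by linarith
      have "\<forall>\<^sub>F n in sequentially. f (r n) q1 < H x + e / 2" "\<forall>\<^sub>F n in sequentially. H x - e / 2 < f (r n) q2"
        using order_tendstoD(2)[OF L L1] order_tendstoD(1)[OF L L2] q1 q2 z1 x by auto
      then have "\<forall>\<^sub>F n in sequentially. norm (f (r n) x - H x) < e"
      proof eventually_elim
        case (elim n)
        then show ?case using mono[of q1 x "r n"] mono[of x q2 "r n"] q1 q2 z1 x e by auto
      qed
      then show "\<exists>no. \<forall>n\<ge>no. norm (f (r n) x - H x) < e" by (simp add: eventually_sequentially)
    qed
  qed
qed

definition l1_dist :: "(real \<Rightarrow> real) \<Rightarrow> (real \<Rightarrow> real) \<Rightarrow> real" where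
  "l1_dist u v = (\<integral>x. \<bar>u x - v x\<bar> \<partial>lebesgue)"

lemma l1_dist_nonneg: "0 \<le> l1_dist u v"
  and l1_dist_commute: "l1_dist u v = l1_dist v u"
  by (auto simp: l1_dist_def abs_minus_commute)

lemma l1_dist_triangle:
  assumes "unit_L1 u" "unit_L1 v" "unit_L1 w"
  shows "l1_dist u w \<le> l1_dist u v + l1_dist v w"
proof -
  have "l1_dist u w \<le> (\<integral>x. \<bar>u x - v x\<bar> + \<bar>v x - w x\<bar> \<partial>lebesgue)"
    unfolding l1_dist_def using assms
    by (intro integral_mono Bochner_Integration.integrable_add integrable_abs Bochner_Integration.integrable_diff) auto
  also have "\<dots> = l1_dist u v + l1_dist v w"
    unfolding l1_dist_def using assms
    by (intro Bochner_Integration.integral_add integrable_abs Bochner_Integration.integrable_diff) auto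
  finally show ?thesis .
qed

lemma l1_dist_AE:
  assumes "unit_L1 u" "unit_L1 v" shows "l1_dist u v = 0 \<longleftrightarrow> (AE x in lebesgue. u x = v x)"
proof -
  have "l1_dist u v = 0 \<longleftrightarrow> (AE x in lebesgue. \<bar>u x - v x\<bar> = 0)"
    unfolding l1_dist_def using assms
    by (intro integral_nonneg_eq_0_iff_AE integrable_abs Bochner_Integration.integrable_diff) auto
  then show ?thesis by simp
qed

lemma l1_dist_integral:
  assumes "unit_L1 u" "unit_L1 v"
  shows "\<bar>(\<integral>x. u x \<partial>lebesgue) - (\<integral>x. v x \<partial>lebesgue)\<bar> \<le> l1_dist u v"
proof -
  have "(\<integral>x. u x \<partial>lebesgue) - (\<integral>x. v x \<partial>lebesgue) = (\<integral>x. u x - v x \<partial>lebesgue)"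
    using assms by (intro Bochner_Integration.integral_diff[symmetric]) auto
  then show ?thesis unfolding l1_dist_def by simp
qed

lemma integrable_powr_dominator:
  fixes \<alpha> C :: real
  assumes "\<alpha> < 1"
  shows "integrable lebesgue (\<lambda>x. indicator {0<..1} x * (C * x powr - \<alpha>))"
proof -
  have "(\<lambda>x. x powr - \<alpha>) absolutely_integrable_on {0<..1}"
    using integrable_on_powr_from_0'[of "- \<alpha>" 1] assms
    by (subst absolutely_integrable_on_iff_nonneg) auto
  then have "integrable lebesgue (\<lambda>x. C * (indicator {0<..1} x * x powr - \<alpha>))"
    by (simp add: set_integrable_def)
  then show ?thesis by (simp add: mult.left_commute)
qed

text \<open>The majorant \<open>C * x powr - \<alpha>\<close> is integrable because \<open>\<alpha> < 1\<close>; it prevents mass from escaping into 0, so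
that pointwise convergence along a subsequence improves to convergence in mean.\<close>

lemma decreasing_profiles_compact:
  fixes f :: "nat \<Rightarrow> real \<Rightarrow> real"
  assumes f: "\<And>n. decreasing_profile (f n)" "\<And>n. unit_L1 (f n)"
    and C: "0 \<le> C" "\<alpha> < 1" "\<And>n x. x \<in> {0<..<1} \<Longrightarrow> f n x \<le> C * x powr - \<alpha>"
  obtains r H where "strict_mono (r :: nat \<Rightarrow> nat)" "decreasing_profile H" "unit_L1 H"
    "(\<lambda>n. l1_dist (f (r n)) H) \<longlonglongrightarrow> 0"
proof -
  note f0 = decreasing_profileD[OF f(1)]
  have bounds: "0 \<le> f n x \<and> f n x \<le> C * x powr - \<alpha>" if "0 < x" for n x
    using f0(1)[of n x] f0(3)[of x n] C(1) C(3)[of x n] that by (cases "x < 1") auto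
  obtain r H where r: "strict_mono (r :: nat \<Rightarrow> nat)" and H: "\<And>x. 0 < x \<Longrightarrow> 0 \<le> H x"
    "\<And>x y. 0 < x \<Longrightarrow> x \<le> y \<Longrightarrow> H y \<le> H x"
    and lim: "\<And>x. 0 < x \<Longrightarrow> isCont H x \<Longrightarrow> (\<lambda>n. f (r n) x) \<longlonglongrightarrow> H x"
    using decreasing_selection[of f "\<lambda>x. C * x powr - \<alpha>"] f0(2) bounds by blast
  define G where "G x = (if 0 < x \<and> x < 1 then H x else 0)" for x
  have G: "decreasing_profile G"
    using H by (auto simp: decreasing_profile_def G_def vanishes_outside_def)
  have "AE x in lebesgue. x \<notin> {x. 0 < x \<and> \<not> isCont H x}"
    using H(2) by (intro AE_lebesgue_countable decreasing_discont_countable)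
  then have AE_lim: "AE x in lebesgue. (\<lambda>n. f (r n) x) \<longlonglongrightarrow> G x"
  proof eventually_elim
    case (elim x)
    then show ?case
    proof (cases "0 < x \<and> x < 1")
      case True
      then show ?thesis using elim lim[of x] by (auto simp: G_def)
    next
      case False
      then have "f (r n) x = 0" for n using f0(3)[of x "r n"] by auto
      then show ?thesis using False by (auto simp: G_def)
    qed
  qed
  let ?w = "\<lambda>x. indicator {0<..1} x * (C * x powr - \<alpha>)"
  have fm: "f n \<in> borel_measurable lebesgue" for n using f(2)[of n] by (auto simp: unit_L1_def)
  have Gm: "G \<in> borel_measurable lebesgue"
  proof (rule borel_measurable_AE)
    show "(\<lambda>x. lim (\<lambda>n. f (r n) x)) \<in> borel_measurable lebesgue"
      by (rule borel_measurable_lim_metric) (rule fm)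
    show "AE x in lebesgue. lim (\<lambda>n. f (r n) x) = G x"
      using AE_lim by eventually_elim (rule limI)
  qed
  have fw: "norm (f n x) \<le> ?w x" for n x
    using bounds[of x n] f0(3)[of x n] by (cases "0 < x \<and> x < 1") (auto simp: indicator_def not_less)
  have "integrable lebesgue G"
    by (rule integrable_dominated_convergence[OF Gm fm integrable_powr_dominator[OF C(2)] AE_lim, of C])
       (rule AE_I2, rule fw)
  then have GL: "unit_L1 G" by (auto simp: unit_L1_def vanishes_outside_def G_def)
  have Gw: "AE x in lebesgue. norm (G x) \<le> ?w x"
    using AE_lim
  proof eventually_elim
    case (elim x)
    show ?case by (rule LIMSEQ_le_const2[OF tendsto_norm[OF elim]]) (use fw in auto)
  qed
  have "(\<lambda>n. \<integral>x. \<bar>f (r n) x - G x\<bar> \<partial>lebesgue) \<longlonglongrightarrow> integral\<^sup>L lebesgue (\<lambda>x::real. 0 :: real)"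
  proof (rule integral_dominated_convergence[where w="\<lambda>x. 2 * ?w x"])
    show "integrable lebesgue (\<lambda>x. 2 * ?w x)" using integrable_powr_dominator[OF C(2), of C] by auto
    show "AE x in lebesgue. (\<lambda>n. \<bar>f (r n) x - G x\<bar>) \<longlonglongrightarrow> 0"
      using AE_lim by eventually_elim (auto intro: tendsto_rabs_zero LIM_zero)
    show "AE x in lebesgue. norm \<bar>f (r n) x - G x\<bar> \<le> 2 * ?w x" for n
      using Gw
    proof eventually_elim
      case (elim x)
      then show ?case using fw[of "r n" x] by (auto simp: abs_le_iff)
    qed
  qed (use fm Gm in auto)
  then have "(\<lambda>n. l1_dist (f (r n)) G) \<longlonglongrightarrow> 0" by (simp add: l1_dist_def)
  then show ?thesis using that[OF r G GL] by blast
qed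

section \<open>Uniqueness of the decreasing fixed point\<close>

text \<open>Strict expansion is uniform on intervals of length at least \<open>\<eta>\<close>: the gain in length is a positive
continuous function of the end points, and these range over a compact set.\<close>

lemma expanding_on_uniform:
  assumes \<phi>: "expanding_on l r \<phi>" and \<eta>: "0 < \<eta>"
  obtains c where "c > 0" "\<And>a b. l \<le> a \<Longrightarrow> b \<le> r \<Longrightarrow> \<eta> \<le> b - a \<Longrightarrow> b - a + c \<le> \<phi> b - \<phi> a"
proof -
  let ?K = "({l..r} \<times> {l..r}) \<inter> {z. \<eta> \<le> snd z - fst z}"
  let ?d = "\<lambda>z. (\<phi> (snd z) - \<phi> (fst z)) - (snd z - fst z)"
  have "closed {z :: real \<times> real. \<eta> \<le> snd z - fst z}"
    by (intro closed_Collect_le continuous_intros)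
  then have K: "compact ?K" by (intro compact_Int_closed compact_Times) auto
  have cont: "continuous_on {l..r} \<phi>" using \<phi> by (simp add: expanding_on_def)
  have "continuous_on ?K ?d"
    by (intro continuous_intros continuous_on_compose2[OF cont]) auto
  have pos: "0 < ?d z" if "z \<in> ?K" for z
    using expanding_on_less[OF \<phi>, of "fst z" "snd z"] that \<eta> by auto
  show ?thesis
  proof (cases "?K = {}")
    case True
    then have "False" if "l \<le> a" "b \<le> r" "\<eta> \<le> b - a" for a b
    proof -
      have "(a, b) \<in> ?K" using that \<eta> by auto
      with True show False by blast
    qed
    then show ?thesis using that[of 1] by auto
  next
    case False
    obtain z where z: "z \<in> ?K" "\<And>y. y \<in> ?K \<Longrightarrow> ?d z \<le> ?d y"
      using continuous_attains_inf[OF K False \<open>continuous_on ?K ?d\<close>] by blast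
    show ?thesis
    proof (rule that[OF pos[OF z(1)]])
      fix a b assume "l \<le> a" "b \<le> r" "\<eta> \<le> b - a"
      then have "(a, b) \<in> ?K" using \<eta> by auto
      from z(2)[OF this] show "b - a + ?d z \<le> \<phi> b - \<phi> a" by simp
    qed
  qed
qed

text \<open>\<open>P s t\<close> stands for a property of the open interval from \<open>s\<close> to \<open>t\<close> that passes to subintervals and to
images under the branches. As long as \<open>1/2\<close> is not an interior point, the image of the interval is
an interval that is longer by at least a fixed amount, which cannot go on forever in \<open>{0..1}\<close>. Once \<open>1/2\<close> is an
interior point, the part to its right is mapped to an interval that starts at 0.\<close>

lemma interval_reaches_0:
  fixes P :: "real \<Rightarrow> real \<Rightarrow> bool"
  assumes ag: "0 < a" "right_branch g"
    and sub: "\<And>s t s' t'. P s t \<Longrightarrow> s \<le> s' \<Longrightarrow> t' \<le> t \<Longrightarrow> P s' t'"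
    and push: "\<And>i s t. i \<in> {1,2} \<Longrightarrow> left_end i \<le> s \<Longrightarrow> s < t \<Longrightarrow> t \<le> right_end i \<Longrightarrow> P s t \<Longrightarrow>
       P (branch a g i s) (branch a g i t)"
    and P0: "P s0 t0" "0 \<le> s0" "s0 < t0" "t0 \<le> 1"
  shows "\<exists>t>0. P 0 t"
proof -
  have ex: "expanding_on (left_end i) (right_end i) (branch a g i)" for i
    by (rule expanding_on_branch[OF ag])
  have range: "0 \<le> branch a g i s \<and> branch a g i s \<le> 1" if "left_end i \<le> s" "s \<le> right_end i" for i s
  proof -
    have "branch a g i (left_end i) = 0" "branch a g i (right_end i) \<le> 1"
      using ag by (auto simp: branch_def left_end_def right_end_def right_branch_def Pi_iff)
    moreover have "branch a g i (left_end i) \<le> branch a g i s" "branch a g i s \<le> branch a g i (right_end i)"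
      using expanding_on_less[OF ex, of i "left_end i" s] expanding_on_less[OF ex, of i s "right_end i"] that
      by (cases "s = left_end i"; cases "s = right_end i"; auto)+
    ultimately show ?thesis by auto
  qed
  have "\<exists>s t. 0 \<le> s \<and> s < 1/2 \<and> 1/2 < t \<and> t \<le> 1 \<and> P s t"
  proof (rule ccontr)
    assume no: "\<not> ?thesis"
    define \<eta> where "\<eta> = t0 - s0"
    have \<eta>: "0 < \<eta>" using P0 by (simp add: \<eta>_def)
    obtain c1 where c1: "c1 > 0" "\<And>s t. left_end 1 \<le> s \<Longrightarrow> t \<le> right_end 1 \<Longrightarrow> \<eta> \<le> t - s \<Longrightarrow>
        t - s + c1 \<le> branch a g 1 t - branch a g 1 s"
      using expanding_on_uniform[OF ex \<eta>] by metis
    obtain c2 where c2: "c2 > 0" "\<And>s t. left_end 2 \<le> s \<Longrightarrow> t \<le> right_end 2 \<Longrightarrow> \<eta> \<le> t - s \<Longrightarrow>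
        t - s + c2 \<le> branch a g 2 t - branch a g 2 s"
      using expanding_on_uniform[OF ex \<eta>] by metis
    define c where "c = min c1 c2"
    have c: "0 < c" "c \<le> c1" "c \<le> c2" using c1 c2 by (auto simp: c_def)
    have "\<exists>s t. 0 \<le> s \<and> t \<le> 1 \<and> P s t \<and> \<eta> + real n * c \<le> t - s" for n
    proof (induction n)
      case 0
      then show ?case using P0 by (auto simp: \<eta>_def)
    next
      case (Suc n)
      then obtain s t where st: "0 \<le> s" "t \<le> 1" "P s t" "\<eta> + real n * c \<le> t - s" by blast
      have \<eta>st: "\<eta> \<le> t - s" using st(4) c(1) by (smt (verit) mult_nonneg_nonneg of_nat_0_le_iff)
      then have "s < t" using \<eta> by simp
      have "t \<le> 1/2 \<or> 1/2 \<le> s" using no st by (meson not_le)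
      then have "(left_end 1 \<le> s \<and> t \<le> right_end 1) \<or> (left_end 2 \<le> s \<and> t \<le> right_end 2)"
        using st by (auto simp: left_end_def right_end_def)
      then obtain i where i: "i \<in> {1, 2}" "left_end i \<le> s" "t \<le> right_end i" by blast
      have "t - s + c \<le> branch a g i t - branch a g i s"
        using i c1(2)[of s t] c2(2)[of s t] c \<eta>st by auto
      moreover have "P (branch a g i s) (branch a g i t)"
        using push[OF i(1,2) \<open>s < t\<close> i(3) st(3)] .
      ultimately show ?case
        using range[of i s] range[of i t] i \<open>s < t\<close> st(4)
        by (intro exI[of _ "branch a g i s"] exI[of _ "branch a g i t"]) (auto simp: algebra_simps)
    qed
    note long = this
    obtain n where "1 < real n * c" using reals_Archimedean3[OF c(1)] by blast
    moreover obtain s t where "0 \<le> s" "t \<le> 1" "\<eta> + real n * c \<le> t - s" using long[of n] by blast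
    ultimately show False using \<eta> by linarith
  qed
  then obtain s t where st: "0 \<le> s" "s < 1/2" "1/2 < t" "t \<le> 1" "P s t" by blast
  have "P (1/2) t" using sub[OF st(5), of "1/2" t] st by auto
  then have "P (branch a g 2 (1/2)) (branch a g 2 t)"
    using push[of 2 "1/2" t] st by (auto simp: left_end_def right_end_def)
  moreover have g0: "g (1/2) = 0" using ag by (simp add: right_branch_def)
  moreover have "0 < g t"
    using expanding_on_less[OF expanding_on_right_branch[OF ag(2)], of "1/2" t] st g0 by auto
  ultimately show ?thesis by (auto simp: branch_def)
qed

lemma AE_lebesgue_iff_negligible:
  "(AE x in lebesgue. P x) \<longleftrightarrow> negligible {x :: real. \<not> P x}"
proof
  assume "AE x in lebesgue. P x"
  then obtain N where "{x \<in> space lebesgue. \<not> P x} \<subseteq> N" "emeasure lebesgue N = 0" "N \<in> sets lebesgue"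
    by (rule AE_E)
  then have N: "negligible N" "{x. \<not> P x} \<subseteq> N"
    unfolding negligible_iff_null_sets null_sets_def by simp_all
  then show "negligible {x. \<not> P x}" by (rule negligible_subset)
next
  assume "negligible {x. \<not> P x}"
  then show "AE x in lebesgue. P x"
    using AE_not_in[of "{x. \<not> P x}" lebesgue] by (simp add: negligible_iff_null_sets)
qed

context random_map
begin

text \<open>Neither sign nor total mass is prescribed, because differences of invariant densities are needed.\<close>

definition transfer_fixed :: "(real \<Rightarrow> real) \<Rightarrow> bool" where
  "transfer_fixed u \<longleftrightarrow> unit_L1 u \<and> (AE x in lebesgue. transfer u x = u x)"

text \<open>Positivity of the operator gives \<open>transfer (max 0 u) \<ge> max 0 (transfer u) = max 0 u\<close>, and both ends have the same
integral.\<close>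

lemma transfer_fixed_pos_part:
  assumes u: "transfer_fixed u" shows "transfer_fixed (\<lambda>x. max 0 (u x))"
proof -
  let ?v = "\<lambda>x. max 0 (u x)"
  have uL: "unit_L1 u" and v: "unit_L1 ?v" and inv: "AE x in lebesgue. transfer u x = u x"
    using u by (auto simp: transfer_fixed_def)
  have ge: "transfer u x \<le> transfer ?v x" "0 \<le> transfer ?v x" for x
    using transfer_mono[OF _ uL v, of x] transfer_nonneg[OF _ v, of x] by auto
  have AE: "AE x in lebesgue. 0 \<le> transfer ?v x - ?v x"
    using inv
  proof eventually_elim
    case (elim x)
    then show ?case using ge[of x] by auto
  qed
  have int: "integrable lebesgue (\<lambda>x. transfer ?v x - ?v x)"
    using v by (intro Bochner_Integration.integrable_diff) auto
  have "(\<integral>x. transfer ?v x - ?v x \<partial>lebesgue) = 0"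
    using v unit_L1_transfer[OF v] transfer_integral[OF v] by (subst Bochner_Integration.integral_diff) auto
  then have "AE x in lebesgue. transfer ?v x - ?v x = 0"
    using integral_nonneg_eq_0_iff_AE[OF int AE] by simp
  then show ?thesis using v by (auto simp: transfer_fixed_def)
qed

lemma transfer_fixed_diff:
  assumes "transfer_fixed u" "transfer_fixed v" shows "transfer_fixed (\<lambda>x. u x - v x)"
proof -
  have "AE x in lebesgue. transfer u x = u x" "AE x in lebesgue. transfer v x = v x"
    using assms by (auto simp: transfer_fixed_def)
  then have "AE x in lebesgue. transfer (\<lambda>x. u x - v x) x = u x - v x"
    by eventually_elim (simp add: transfer_diff)
  then show ?thesis using assms by (auto simp: transfer_fixed_def)
qed

definition positive_on :: "(real \<Rightarrow> real) \<Rightarrow> real \<Rightarrow> real \<Rightarrow> bool" where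
  "positive_on v s t \<longleftrightarrow> (AE x in lebesgue. s < x \<and> x < t \<longrightarrow> 0 < v x)"

text \<open>The preimage along branch \<open>i\<close> alone contributes \<open>p y * v y / T' y > 0\<close>. The exceptional null set
is mapped to a null set because the branch is differentiable.\<close>

lemma positive_on_push:
  assumes v: "transfer_fixed v" "\<And>x. 0 \<le> v x"
    and i: "i \<in> {1,2}" "left_end i \<le> s" "s < t" "t \<le> right_end i" and P: "positive_on v s t"
  shows "positive_on v (branch \<alpha> g i s) (branch \<alpha> g i t)"
proof -
  note ag = alpha_pos right_branches(1)
  have vL: "unit_L1 v" and inv: "AE x in lebesgue. transfer v x = v x" using v by (auto simp: transfer_fixed_def)
  have seg: "{s<..<t} \<subseteq> {left_end i<..<right_end i}" using i by auto
  let ?N = "{x. s < x \<and> x < t \<and> \<not> 0 < v x}"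
  have N: "negligible ?N" using P unfolding positive_on_def AE_lebesgue_iff_negligible by (simp add: conj_assoc)
  have "T differentiable_on ?N"
  proof (rule differentiable_at_imp_differentiable_on)
    fix x assume "x \<in> ?N"
    then have "x \<in> {left_end i<..<right_end i}" using seg by auto
    from DERIV_intermittent_map[OF ag this] show "T differentiable at x"
      by (auto simp: real_differentiable_def intro: exI)
  qed
  then have "negligible (T ` ?N)"
    by (intro negligible_differentiable_image_negligible N) auto
  then have "AE x in lebesgue. x \<notin> T ` ?N"
    by (simp add: AE_lebesgue_iff_negligible)
  with inv show ?thesis
    unfolding positive_on_def
  proof (eventually_elim, intro impI, elim conjE)
    fix x assume x: "transfer v x = v x" "x \<notin> T ` ?N" "branch \<alpha> g i s < x" "x < branch \<alpha> g i t"
    have "x \<in> branch \<alpha> g i ` {s<..<t}"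
      using expanding_on_image[OF expanding_on_branch[OF ag, of i] i(2,3,4)] x by auto
    then obtain y where y: "y \<in> {s<..<t}" "x = branch \<alpha> g i y" by blast
    have y': "y \<in> {left_end i<..<right_end i}" using y seg by auto
    then have yd: "y \<in> branch_dom i" "y \<in> {0..1}"
      using open_subset_branch_dom[of i] by (auto simp: left_end_def right_end_def split: if_splits)
    have xT: "x = T y" using y yd by (simp add: intermittent_map_eq_branch)
    have vy: "0 < v y" using x(2) xT y(1) by auto
    have x01: "0 < x" "x < 1"
      using branch_range[OF ag, of i] y(2) y' by (auto simp: image_subset_iff)
    let ?pv = "\<lambda>y. p y * v y" and ?qv = "\<lambda>y. q y * v y"
    have v1: "v 1 = 0" using unit_L1_vanishes[OF vL, of 1] by simp
    have nn: "0 \<le> ?pv z" "0 \<le> ?qv z" for z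
      using v(2)[of z] unit_L1_vanishes[OF vL, of z] pq[of z] by (cases "z \<in> {0..1}"; auto)+
    have "0 < branch_weight T ?pv i x"
      unfolding xT branch_weight_image[OF ag y'] using DERIV_intermittent_map[OF ag y'] vy p_pos[OF yd(2)] by simp
    moreover have "0 \<le> branch_weight T ?pv j x" for j
      by (rule branch_weight_nonneg[OF ag nn(1) _ x01]) (simp add: v1)
    ultimately have "0 < map_transfer T ?pv x"
      using i(1) x01 by (auto simp: map_transfer_def intro: add_pos_nonneg add_nonneg_pos)
    moreover have "0 \<le> map_transfer S ?qv x"
      by (rule map_transfer_nonneg[OF exponents(1) right_branches(2) nn(2)]) (simp add: v1)
    ultimately show "0 < v x" using x(1) by (simp add: transfer_def)
  qed
qed

lemma transfer_fixed_positive_near_0: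
  assumes v: "transfer_fixed v" "\<And>x. 0 \<le> v x"
    and "0 \<le> s" "s < t" "t \<le> 1" "positive_on v s t"
  shows "\<exists>t>0. positive_on v 0 t"
proof (rule interval_reaches_0[OF alpha_pos right_branches(1)])
  show "positive_on v s' t'" if "positive_on v s t" "s \<le> s'" "t' \<le> t" for s t s' t'
    using that(1) unfolding positive_on_def by eventually_elim (use that in auto)
qed (use assms positive_on_push[OF v] in blast)+

text \<open>Two monotone functions are continuous outside a countable set. A point of continuity with \<open>h x < f x\<close> has a
neighbourhood of such points, and this interval can be pushed to 0.\<close>

lemma transfer_fixed_decreasing_diff_le:
  assumes f: "decreasing_profile f" "transfer_fixed f" and h: "decreasing_profile h" "transfer_fixed h"
  shows "(AE x in lebesgue. f x \<le> h x) \<or> (\<exists>t>0. positive_on (\<lambda>x. max 0 (f x - h x)) 0 t)"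
proof (cases "\<exists>x. 0 < x \<and> x < 1 \<and> h x < f x \<and> isCont f x \<and> isCont h x")
  case True
  then obtain x where x: "0 < x" "x < 1" "h x < f x" "isCont f x" "isCont h x" by blast
  have "isCont (\<lambda>z. f z - h z) x" using x by (intro continuous_intros)
  then have "\<forall>\<^sub>F z in at x. 0 < f z - h z"
    using x(3) order_tendstoD(1)[of "\<lambda>z. f z - h z" "f x - h x" "at x" 0] unfolding isCont_def by simp
  then obtain d where d: "0 < d" "\<And>z. z \<noteq> x \<Longrightarrow> dist z x < d \<Longrightarrow> 0 < f z - h z"
    unfolding eventually_at by blast
  define t where "t = min 1 (x + d)"
  have "positive_on (\<lambda>x. max 0 (f x - h x)) x t"
    unfolding positive_on_def using d(2) by (intro AE_I2) (auto simp: t_def dist_real_def)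
  moreover have "x < t" "t \<le> 1" using x d by (auto simp: t_def)
  ultimately show ?thesis
    using transfer_fixed_positive_near_0[OF transfer_fixed_pos_part[OF transfer_fixed_diff[OF f(2) h(2)]], of x t] x
    by auto
next
  case False
  note 0 = AE_lebesgue_countable[OF decreasing_discont_countable]
  have "AE x in lebesgue. x \<notin> {x. 0 < x \<and> \<not> isCont f x}" "AE x in lebesgue. x \<notin> {x. 0 < x \<and> \<not> isCont h x}"
    using 0[of f] 0[of h] decreasing_profileD(2)[OF f(1)] decreasing_profileD(2)[OF h(1)] by blast+
  then have "AE x in lebesgue. f x \<le> h x"
  proof eventually_elim
    case (elim x)
    show ?case
    proof (cases "0 < x \<and> x < 1")
      case True
      then show ?thesis using elim False by (auto simp: not_le[symmetric])
    next
      case False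
      then show ?thesis
        using decreasing_profileD(3)[OF f(1), of x] decreasing_profileD(3)[OF h(1), of x] by auto
    qed
  qed
  then show ?thesis ..
qed

text \<open>If neither density dominates the other, the positive and the negative part of their difference
are both fixed, and both are positive almost everywhere on an interval that starts at 0. But they
have disjoint supports. If one dominates the other, equality of the integrals forces equality.\<close>

theorem decreasing_transfer_fixed_unique:
  assumes f: "decreasing_profile f" "transfer_fixed f" "(\<integral>x. f x \<partial>lebesgue) = 1"
    and h: "decreasing_profile h" "transfer_fixed h" "(\<integral>x. h x \<partial>lebesgue) = 1"
  shows "AE x in lebesgue. f x = h x"
proof -
  note diff_le = transfer_fixed_decreasing_diff_le
  have eq: "AE x in lebesgue. u x = w x"
    if "AE x in lebesgue. u x \<le> w x" "transfer_fixed u" "transfer_fixed w"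
      "(\<integral>x. u x \<partial>lebesgue) = 1" "(\<integral>x. w x \<partial>lebesgue) = 1" for u w
  proof -
    have int: "integrable lebesgue (\<lambda>x. w x - u x)"
      using that by (auto simp: transfer_fixed_def)
    have "(\<integral>x. w x - u x \<partial>lebesgue) = 0"
      using that by (subst Bochner_Integration.integral_diff) (auto simp: transfer_fixed_def)
    then have "AE x in lebesgue. w x - u x = 0"
      using integral_nonneg_eq_0_iff_AE[OF int] that(1) by auto
    then show ?thesis by eventually_elim simp
  qed
  consider "AE x in lebesgue. f x \<le> h x" | "AE x in lebesgue. h x \<le> f x"
    | s t where "0 < s" "0 < t" "positive_on (\<lambda>x. max 0 (f x - h x)) 0 s" "positive_on (\<lambda>x. max 0 (h x - f x)) 0 t"
    using diff_le[OF f(1,2) h(1,2)] diff_le[OF h(1,2) f(1,2)] by blast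
  then show ?thesis
  proof cases
    case 1
    then show ?thesis using eq f h by blast
  next
    case 2
    then have "AE x in lebesgue. h x = f x" using eq f h by blast
    then show ?thesis by eventually_elim simp
  next
    case 3
    have "AE x in lebesgue. x \<notin> {0<..<min s t}"
      using 3(3,4) unfolding positive_on_def by eventually_elim auto
    then have "negligible {0<..<min s t}"
      by (simp only: AE_lebesgue_iff_negligible not_not Collect_mem_eq)
    then have False
      using 3(1,2) open_not_negligible[of "{0<..<min s t}"] by auto
    then show ?thesis ..
  qed
qed

end

context random_map
begin

section \<open>Almost fixed decreasing densities\<close>

lemma transfer_l1_dist:
  assumes "unit_L1 u" "unit_L1 v" shows "l1_dist (transfer u) (transfer v) \<le> l1_dist u v"
  using transfer_contraction[OF unit_L1_diff[OF assms]] by (simp add: l1_dist_def transfer_diff)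

lemma transfer_fixed_iff: "unit_L1 u \<Longrightarrow> transfer_fixed u \<longleftrightarrow> l1_dist (transfer u) u = 0"
  using l1_dist_AE[OF unit_L1_transfer] by (auto simp: transfer_fixed_def)

text \<open>A limit of almost fixed densities is fixed because the operator is a contraction.\<close>

theorem almost_fixed_compact:
  fixes F :: "nat \<Rightarrow> real \<Rightarrow> real"
  assumes F: "\<And>n. decreasing_profile (F n)" "\<And>n. unit_L1 (F n)" "\<And>n. (\<integral>x. F n x \<partial>lebesgue) = 1"
    and C: "0 \<le> C" "\<And>n x. x \<in> {0<..<1} \<Longrightarrow> F n x \<le> C * x powr - \<alpha>"
    and afix: "(\<lambda>n. l1_dist (transfer (F n)) (F n)) \<longlonglongrightarrow> 0"
  obtains r H where "strict_mono (r :: nat \<Rightarrow> nat)" "decreasing_profile H" "transfer_fixed H"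
    "(\<integral>x. H x \<partial>lebesgue) = 1" "(\<lambda>n. l1_dist (F (r n)) H) \<longlonglongrightarrow> 0"
proof -
  obtain r H where r: "strict_mono (r :: nat \<Rightarrow> nat)" and H: "decreasing_profile H" "unit_L1 H"
    and lim: "(\<lambda>n. l1_dist (F (r n)) H) \<longlonglongrightarrow> 0"
    by (rule decreasing_profiles_compact[of F C \<alpha>, OF F(1,2) C(1) exponents(3) C(2)])
  have "l1_dist (transfer H) H \<le> 2 * l1_dist (F (r n)) H + l1_dist (transfer (F (r n))) (F (r n))" for n
  proof -
    let ?f = "F (r n)"
    have "l1_dist (transfer H) H \<le> l1_dist (transfer H) (transfer ?f) + l1_dist (transfer ?f) H"
      using F H by (intro l1_dist_triangle) auto
    moreover have "l1_dist (transfer ?f) H \<le> l1_dist (transfer ?f) ?f + l1_dist ?f H"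
      using F H by (intro l1_dist_triangle) auto
    moreover have "l1_dist (transfer H) (transfer ?f) \<le> l1_dist ?f H"
      using transfer_l1_dist[OF H(2) F(2)[of "r n"]] by (simp add: l1_dist_commute)
    ultimately show ?thesis by linarith
  qed
  moreover have "(\<lambda>n. 2 * l1_dist (F (r n)) H + l1_dist (transfer (F (r n))) (F (r n))) \<longlonglongrightarrow> 2 * 0 + 0"
    using LIMSEQ_subseq_LIMSEQ[OF afix r] by (intro tendsto_intros lim) (simp add: o_def)
  ultimately have "l1_dist (transfer H) H \<le> 0"
    by (intro LIMSEQ_le_const[of _ _ "l1_dist (transfer H) H"]) auto
  then have "l1_dist (transfer H) H = 0" using l1_dist_nonneg[of "transfer H" H] by simp
  then have fixH: "transfer_fixed H" using H by (simp add: transfer_fixed_iff)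
  have "\<bar>1 - (\<integral>x. H x \<partial>lebesgue)\<bar> \<le> 0"
  proof (rule LIMSEQ_le_const[OF lim], intro exI allI impI)
    show "\<bar>1 - (\<integral>x. H x \<partial>lebesgue)\<bar> \<le> l1_dist (F (r n)) H" for n
      using l1_dist_integral[OF F(2) H(2), of "r n"] F(3) by simp
  qed
  then show ?thesis using that[OF r H(1) fixH _ lim] by simp
qed

text \<open>By uniqueness every subsequence has a further subsequence with the same limit \<open>f\<close>. This is used twice: for
averages of iterates of one operator, and for the invariant densities of the perturbed maps, which
are almost fixed by the operator of the unperturbed map.\<close>

theorem almost_fixed_convergent:
  fixes F :: "nat \<Rightarrow> real \<Rightarrow> real"
  assumes F: "\<And>n. decreasing_profile (F n)" "\<And>n. unit_L1 (F n)" "\<And>n. (\<integral>x. F n x \<partial>lebesgue) = 1"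
    and C: "0 \<le> C" "\<And>n x. x \<in> {0<..<1} \<Longrightarrow> F n x \<le> C * x powr - \<alpha>"
    and afix: "(\<lambda>n. l1_dist (transfer (F n)) (F n)) \<longlonglongrightarrow> 0"
    and f: "decreasing_profile f" "transfer_fixed f" "(\<integral>x. f x \<partial>lebesgue) = 1"
  shows "(\<lambda>n. l1_dist (F n) f) \<longlonglongrightarrow> 0"
proof (rule ccontr)
  have f_unit_L1: "unit_L1 f" using f(2) by (simp add: transfer_fixed_def)
  assume "\<not> ?thesis"
  then obtain e where e: "e > 0" "\<not> (\<forall>\<^sub>F n in sequentially. dist (l1_dist (F n) f) 0 < e)"
    unfolding tendsto_iff by blast
  then have "infinite {n. e \<le> l1_dist (F n) f}"
    by (simp add: frequently_cofinite[symmetric] cofinite_eq_sequentially not_eventually not_less l1_dist_nonneg)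
  then obtain s where s: "strict_mono (s :: nat \<Rightarrow> nat)" "\<And>n. e \<le> l1_dist (F (s n)) f"
    using infinite_enumerate by blast
  obtain r H where r: "strict_mono (r :: nat \<Rightarrow> nat)" and H: "decreasing_profile H" "transfer_fixed H"
    "(\<integral>x. H x \<partial>lebesgue) = 1" and lim: "(\<lambda>n. l1_dist (F (s (r n))) H) \<longlonglongrightarrow> 0"
    by (rule almost_fixed_compact[of "\<lambda>n. F (s n)" C, OF F C LIMSEQ_subseq_LIMSEQ[OF afix s(1), unfolded o_def]])
  have HL: "unit_L1 H" using H(2) by (simp add: transfer_fixed_def)
  have "l1_dist H f = 0"
    using decreasing_transfer_fixed_unique[OF H f] l1_dist_AE[OF HL f_unit_L1] by simp
  then have "e \<le> l1_dist (F (s (r n))) H" for n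
    using l1_dist_triangle[OF F(2) HL f_unit_L1, of "s (r n)"] s(2)[of "r n"] by simp
  then have "e \<le> 0" using LIMSEQ_le_const[OF lim] by blast
  then show False using e(1) by simp
qed

section \<open>Averages of the iterates\<close>

definition cesaro :: "nat \<Rightarrow> (real \<Rightarrow> real) \<Rightarrow> real \<Rightarrow> real" where
  "cesaro n u x = 1 / real (Suc n) * (\<Sum>k<Suc n. (transfer ^^ k) u x)"

lemma transfer_pow_add: "(transfer ^^ k) (\<lambda>y. u y + v y) = (\<lambda>x. (transfer ^^ k) u x + (transfer ^^ k) v x)"
  by (induction k) (auto simp: transfer_add)

lemma transfer_pow_diff: "(transfer ^^ k) (\<lambda>y. u y - v y) = (\<lambda>x. (transfer ^^ k) u x - (transfer ^^ k) v x)"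
  by (induction k) (auto simp: transfer_diff)

lemma transfer_pow_scale: "(transfer ^^ k) (\<lambda>y. c * u y) = (\<lambda>x. c * (transfer ^^ k) u x)"
  by (induction k) (auto simp: transfer_scale)

lemma unit_L1_transfer_pow: "unit_L1 u \<Longrightarrow> unit_L1 ((transfer ^^ k) u)"
  by (induction k) auto

lemma integral_transfer_pow:
  "unit_L1 u \<Longrightarrow> (\<integral>x. (transfer ^^ k) u x \<partial>lebesgue) = (\<integral>x. u x \<partial>lebesgue)"
  by (induction k) (auto simp: transfer_integral unit_L1_transfer_pow)

lemma decreasing_profile_transfer_pow: "decreasing_profile u \<Longrightarrow> decreasing_profile ((transfer ^^ k) u)"
  by (induction k) (auto simp: decreasing_profile_transfer)

lemma transfer_pow_contraction:
  assumes u: "unit_L1 u" shows "(\<integral>x. \<bar>(transfer ^^ k) u x\<bar> \<partial>lebesgue) \<le> (\<integral>x. \<bar>u x\<bar> \<partial>lebesgue)"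
proof (induction k)
  case (Suc k)
  then show ?case using transfer_contraction[OF unit_L1_transfer_pow[OF u, of k]] by simp
qed simp

lemma transfer_sum:
  "finite K \<Longrightarrow> transfer (\<lambda>y. \<Sum>k\<in>K. u k y) x = (\<Sum>k\<in>K. transfer (u k) x)"
proof (induction K rule: finite_induct)
  case empty
  then show ?case using transfer_scale[of 0 "\<lambda>_. 0" x] by simp
next
  case (insert k K)
  then show ?case using transfer_add[of "u k" "\<lambda>y. \<Sum>k\<in>K. u k y" x] by simp
qed

lemma unit_L1_cesaro [intro]:
  assumes u: "unit_L1 u" shows "unit_L1 (cesaro n u)"
  unfolding cesaro_def[abs_def] by (intro unit_L1_scale unit_L1_sum unit_L1_transfer_pow[OF u])

lemma integral_cesaro:
  assumes u: "unit_L1 u" shows "(\<integral>x. cesaro n u x \<partial>lebesgue) = (\<integral>x. u x \<partial>lebesgue)"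
proof -
  have "(\<integral>x. (\<Sum>k<Suc n. (transfer ^^ k) u x) \<partial>lebesgue) = (\<Sum>k<Suc n. (\<integral>x. (transfer ^^ k) u x \<partial>lebesgue))"
    by (intro Bochner_Integration.integral_sum unit_L1_integrable unit_L1_transfer_pow u)
  then show ?thesis
    unfolding cesaro_def[abs_def] integral_mult_right_zero by (simp add: integral_transfer_pow[OF u] del: sum.lessThan_Suc)
qed

lemma decreasing_profile_cesaro:
  assumes "decreasing_profile u" shows "decreasing_profile (cesaro n u)"
proof -
  note D = decreasing_profileD[OF decreasing_profile_transfer_pow[OF assms]]
  show ?thesis
    unfolding decreasing_profile_def vanishes_outside_def cesaro_def
    by (intro conjI allI impI mult_nonneg_nonneg mult_left_mono sum_nonneg sum_mono D) (auto simp: D(3))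
qed

text \<open>The sum telescopes, so an average is fixed up to an error of order \<open>1 / n\<close>.\<close>

lemma transfer_cesaro:
  "transfer (cesaro n u) x = cesaro n u x + 1 / real (Suc n) * ((transfer ^^ Suc n) u x - u x)"
proof -
  have "transfer (cesaro n u) x = 1 / real (Suc n) * (\<Sum>k<Suc n. (transfer ^^ Suc k) u x)"
    unfolding cesaro_def[abs_def] transfer_scale by (subst transfer_sum) auto
  also have "(\<Sum>k<Suc n. (transfer ^^ Suc k) u x) = (\<Sum>k<Suc n. (transfer ^^ k) u x) + ((transfer ^^ Suc n) u x - u x)"
    using sum_lessThan_telescope[of "\<lambda>k. (transfer ^^ k) u x" "Suc n"] by (simp add: sum_subtractf algebra_simps)
  finally show ?thesis unfolding cesaro_def[of n u x] distrib_left .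
qed

lemma cesaro_add: "cesaro n (\<lambda>y. u y + v y) x = cesaro n u x + cesaro n v x"
  unfolding cesaro_def transfer_pow_add sum.distrib by (simp add: distrib_left)

lemma cesaro_scale: "cesaro n (\<lambda>y. c * u y) x = c * cesaro n u x"
  unfolding cesaro_def transfer_pow_scale sum_distrib_left[symmetric] by simp

lemma cesaro_l1_dist:
  assumes u: "unit_L1 u" and v: "unit_L1 v"
  shows "l1_dist (cesaro n u) (cesaro n v) \<le> l1_dist u v"
proof -
  let ?d = "\<lambda>k x. (transfer ^^ k) (\<lambda>y. u y - v y) x"
  have dL: "unit_L1 (?d k)" for k by (intro unit_L1_transfer_pow unit_L1_diff u v)
  have "cesaro n u x - cesaro n v x = 1 / real (Suc n) * (\<Sum>k<Suc n. ?d k x)" for x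
    unfolding cesaro_def transfer_pow_diff sum_subtractf by (simp add: right_diff_distrib)
  then have "l1_dist (cesaro n u) (cesaro n v) = (\<integral>x. 1 / real (Suc n) * \<bar>\<Sum>k<Suc n. ?d k x\<bar> \<partial>lebesgue)"
    unfolding l1_dist_def by (simp add: abs_mult)
  also have "\<dots> \<le> (\<integral>x. 1 / real (Suc n) * (\<Sum>k<Suc n. \<bar>?d k x\<bar>) \<partial>lebesgue)"
    by (intro integral_mono mult_left_mono sum_abs unit_L1_integrable unit_L1_scale unit_L1_abs unit_L1_sum dL) auto
  also have "\<dots> = 1 / real (Suc n) * (\<Sum>k<Suc n. (\<integral>x. \<bar>?d k x\<bar> \<partial>lebesgue))"
    unfolding integral_mult_right_zero
    by (subst Bochner_Integration.integral_sum) (intro unit_L1_integrable unit_L1_abs dL refl)+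
  also have "\<dots> \<le> 1 / real (Suc n) * (\<Sum>k<Suc n. l1_dist u v)"
    using transfer_pow_contraction[OF unit_L1_diff[OF u v]] unfolding l1_dist_def
    by (intro mult_left_mono sum_mono) auto
  also have "\<dots> = l1_dist u v" by simp
  finally show ?thesis .
qed

lemma cesaro_fixed:
  assumes "transfer_fixed u" shows "l1_dist (cesaro n u) u = 0"
proof -
  have u: "unit_L1 u" using assms by (simp add: transfer_fixed_def)
  have "l1_dist ((transfer ^^ k) u) u = 0" for k
  proof (induction k)
    case 0
    then show ?case by (simp add: l1_dist_def)
  next
    case (Suc k)
    have "l1_dist ((transfer ^^ Suc k) u) u \<le> l1_dist (transfer ((transfer ^^ k) u)) (transfer u) + l1_dist (transfer u) u"
      using l1_dist_triangle[of "transfer ((transfer ^^ k) u)" "transfer u" u] unit_L1_transfer_pow u by auto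
    also have "l1_dist (transfer u) u = 0" using assms u transfer_fixed_iff by blast
    also have "l1_dist (transfer ((transfer ^^ k) u)) (transfer u) \<le> 0"
      using transfer_l1_dist[OF unit_L1_transfer_pow[OF u, of k] u] Suc by simp
    finally show ?case using l1_dist_nonneg[of "(transfer ^^ Suc k) u" u] by simp
  qed
  then have "AE x in lebesgue. (transfer ^^ k) u x = u x" for k
    using l1_dist_AE[OF unit_L1_transfer_pow[OF u] u] by simp
  then have "AE x in lebesgue. \<forall>k. (transfer ^^ k) u x = u x" by (simp add: AE_all_countable)
  then have "AE x in lebesgue. cesaro n u x = u x"
  proof eventually_elim
    case (elim x)
    then show ?case unfolding cesaro_def by simp
  qed
  then show ?thesis using l1_dist_AE[OF unit_L1_cesaro[OF u] u] by simp
qed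

text \<open>For a bounded decreasing density the error is bounded pointwise from below by \<open>- M\<close>, which is what
the bound near 0 asks for.\<close>

lemma cesaro_almost_fixed:
  assumes u: "decreasing_profile u" "unit_L1 u" "(\<integral>x. u x \<partial>lebesgue) = 1" and M: "\<And>x. u x \<le> M"
  shows "x \<in> {0<..<1} \<Longrightarrow> cesaro n u x \<le> 2 * (2 + M) * x powr - \<alpha>"
    and "(\<lambda>n. l1_dist (transfer (cesaro n u)) (cesaro n u)) \<longlonglongrightarrow> 0"
proof -
  have M0: "0 \<le> M" using M[of 0] decreasing_profileD(1)[OF u(1), of 0] by simp
  have "cesaro n u x \<le> transfer (cesaro n u) x + M" for x
  proof -
    have "0 \<le> (transfer ^^ Suc n) u x" by (rule decreasing_profileD(1)[OF decreasing_profile_transfer_pow[OF u(1)]])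
    then have "u x - (transfer ^^ Suc n) u x \<le> M" using M[of x] by linarith
    then have "1 / real (Suc n) * (u x - (transfer ^^ Suc n) u x) \<le> 1 / real (Suc n) * M"
      by (rule mult_left_mono) simp
    also have "\<dots> \<le> 1 * M" using M0 by (intro mult_right_mono) auto
    finally have "1 / real (Suc n) * (u x - (transfer ^^ Suc n) u x) \<le> M" by simp
    then show ?thesis unfolding transfer_cesaro by (simp add: right_diff_distrib)
  qed
  then show "x \<in> {0<..<1} \<Longrightarrow> cesaro n u x \<le> 2 * (2 + M) * x powr - \<alpha>"
    using u M0 by (intro decreasing_profile_bound decreasing_profile_cesaro) (auto simp: integral_cesaro)
  have le: "l1_dist (transfer (cesaro n u)) (cesaro n u) \<le> 2 * (1 / real (Suc n))" for n
  proof -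
    have "l1_dist (transfer (cesaro n u)) (cesaro n u) = (\<integral>x. 1 / real (Suc n) * \<bar>(transfer ^^ Suc n) u x - u x\<bar> \<partial>lebesgue)"
      unfolding l1_dist_def transfer_cesaro by (simp add: abs_mult)
    also have "\<dots> \<le> (\<integral>x. 1 / real (Suc n) * ((transfer ^^ Suc n) u x + u x) \<partial>lebesgue)"
    proof (rule integral_mono)
      have "0 \<le> (transfer ^^ Suc n) u x" "0 \<le> u x" for x
        using decreasing_profileD(1)[OF decreasing_profile_transfer_pow[OF u(1)]] decreasing_profileD(1)[OF u(1)] by blast+
      then show "1 / real (Suc n) * \<bar>(transfer ^^ Suc n) u x - u x\<bar> \<le> 1 / real (Suc n) * ((transfer ^^ Suc n) u x + u x)" for x
        by (intro mult_left_mono) (auto simp: abs_le_iff)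
    qed (intro unit_L1_integrable unit_L1_scale unit_L1_abs unit_L1_diff unit_L1_add unit_L1_transfer_pow u)+
    also have "\<dots> = 1 / real (Suc n) * ((\<integral>x. (transfer ^^ Suc n) u x \<partial>lebesgue) + (\<integral>x. u x \<partial>lebesgue))"
      unfolding integral_mult_right_zero
      by (subst Bochner_Integration.integral_add) (intro unit_L1_integrable unit_L1_transfer_pow u refl)+
    also have "\<dots> = 2 * (1 / real (Suc n))"
      unfolding integral_transfer_pow[OF u(2)] u(3) by simp
    finally show ?thesis .
  qed
  have lim: "(\<lambda>n. 2 * (1 / real (Suc n))) \<longlonglongrightarrow> 2 * 0"
    by (intro tendsto_mult tendsto_const LIMSEQ_inverse_real_of_nat[unfolded inverse_eq_divide])
  show "(\<lambda>n. l1_dist (transfer (cesaro n u)) (cesaro n u)) \<longlonglongrightarrow> 0"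
  proof (rule tendsto_sandwich)
    show "\<forall>\<^sub>F n in sequentially. 0 \<le> l1_dist (transfer (cesaro n u)) (cesaro n u)"
      by (simp add: l1_dist_nonneg)
    show "\<forall>\<^sub>F n in sequentially. l1_dist (transfer (cesaro n u)) (cesaro n u) \<le> 2 * (1 / real (Suc n))"
      using le by (intro always_eventually allI)
  qed (use lim in \<open>simp_all only: mult_zero_right tendsto_const\<close>)
qed

lemma unit_L1_indicator: "A \<in> sets borel \<Longrightarrow> unit_L1 (\<lambda>x. indicator (A \<inter> {0<..<1}) x)"
proof -
  assume "A \<in> sets borel"
  then have "integrable lebesgue (\<lambda>x. indicator A x *\<^sub>R (indicator {0<..<1::real} x :: real))"
    by (intro integrable_mult_indicator) (auto simp: integrable_indicator_iff)
  then show ?thesis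
    by (auto simp: unit_L1_def vanishes_outside_def indicator_inter_arith)
qed

lemma decreasing_profile_uniform:
  assumes "0 < t" "t \<le> 1"
  defines "u \<equiv> \<lambda>x::real. 1 / t * indicator {0<..<t} x"
  shows "decreasing_profile u" "unit_L1 u" "(\<integral>x. u x \<partial>lebesgue) = 1" "u x \<le> 1 / t"
proof -
  show "decreasing_profile u"
    using assms by (auto simp: decreasing_profile_def vanishes_outside_def indicator_def)
  have "{0<..<t} \<inter> {0<..<1} = {0<..<t}" using assms by auto
  then have "unit_L1 (\<lambda>x. indicator {0<..<t} x)" using unit_L1_indicator[of "{0<..<t}"] by simp
  then show "unit_L1 u" unfolding u_def by (rule unit_L1_scale)
  show "(\<integral>x. u x \<partial>lebesgue) = 1"
    unfolding u_def integral_mult_right_zero using assms(1) by (simp add: measure_def)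
  show "u x \<le> 1 / t" using assms by (auto simp: indicator_def)
qed

lemma transfer_fixed_bound:
  assumes f: "decreasing_profile f" "transfer_fixed f" "(\<integral>x. f x \<partial>lebesgue) = 1" and x: "x \<in> {0<..<1}"
  shows "f x \<le> 4 * x powr - \<alpha>"
proof -
  have "AE x in lebesgue. transfer f x = f x" using f(2) by (simp add: transfer_fixed_def)
  then have "AE x in lebesgue. x \<in> {0<..<1} \<longrightarrow> f x \<le> transfer f x + 0"
    by eventually_elim simp
  from decreasing_profile_bound[OF f(1) _ f(3) order_refl this x] f(2) show ?thesis
    by (simp add: transfer_fixed_def)
qed

text \<open>The limit of averages of the uniform density, along a subsequence.\<close>

lemma decreasing_transfer_fixed_exists:
  obtains f where "decreasing_profile f" "transfer_fixed f" "(\<integral>x. f x \<partial>lebesgue) = 1"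
    "\<And>x. x \<in> {0<..<1} \<Longrightarrow> f x \<le> 4 * x powr - \<alpha>"
proof -
  let ?u = "\<lambda>x. 1 / 1 * indicator {0<..<1::real} x"
  note u = decreasing_profile_uniform[of 1, OF zero_less_one order_refl]
  obtain r H where H: "decreasing_profile H" "transfer_fixed H" "(\<integral>x. H x \<partial>lebesgue) = 1"
  proof (rule almost_fixed_compact[of "\<lambda>n. cesaro n ?u" "2 * (2 + 1)"])
    show "cesaro n ?u x \<le> 2 * (2 + 1) * x powr - \<alpha>" if "x \<in> {0<..<1}" for n x
      using cesaro_almost_fixed(1)[OF u(1,2,3), of 1] u(4) that by simp
    show "(\<lambda>n. l1_dist (transfer (cesaro n ?u)) (cesaro n ?u)) \<longlonglongrightarrow> 0"
      by (rule cesaro_almost_fixed(2)[OF u])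
  qed (use u in \<open>auto simp: decreasing_profile_cesaro integral_cesaro\<close>)
  moreover have "H x \<le> 4 * x powr - \<alpha>" if "x \<in> {0<..<1}" for x
    by (rule transfer_fixed_bound[OF H that])
  ultimately show ?thesis using that[of H] by simp
qed

end

section \<open>Convergence of the averages of an arbitrary function\<close>

lemma l1_dist_add_le:
  assumes "unit_L1 a" "unit_L1 b" "unit_L1 c" "unit_L1 d"
  shows "l1_dist (\<lambda>x. a x + b x) (\<lambda>x. c x + d x) \<le> l1_dist a c + l1_dist b d"
proof -
  have "l1_dist (\<lambda>x. a x + b x) (\<lambda>x. c x + d x) \<le> (\<integral>x. \<bar>a x - c x\<bar> + \<bar>b x - d x\<bar> \<partial>lebesgue)"
    unfolding l1_dist_def using assms
    by (intro integral_mono unit_L1_integrable unit_L1_add unit_L1_abs unit_L1_diff) auto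
  also have "\<dots> = l1_dist a c + l1_dist b d"
    unfolding l1_dist_def using assms
    by (intro Bochner_Integration.integral_add unit_L1_integrable unit_L1_abs unit_L1_diff)
  finally show ?thesis .
qed

lemma l1_dist_scale: "l1_dist (\<lambda>x. c * u x) (\<lambda>x. c * v x) = \<bar>c\<bar> * l1_dist u v"
  by (simp add: l1_dist_def abs_mult flip: right_diff_distrib)

context random_map
begin

definition averages_converge :: "(real \<Rightarrow> real) \<Rightarrow> (real \<Rightarrow> real) \<Rightarrow> bool" where
  "averages_converge f v \<longleftrightarrow> (\<lambda>n. l1_dist (cesaro n v) (\<lambda>x. (\<integral>y. v y \<partial>lebesgue) * f x)) \<longlonglongrightarrow> 0"

context
  fixes f assumes f: "decreasing_profile f" "transfer_fixed f" "(\<integral>x. f x \<partial>lebesgue) = 1"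
begin

lemma f_unit_L1: "unit_L1 f" using f(2) by (simp add: transfer_fixed_def)

lemma averages_converge_scale:
  assumes "averages_converge f v" shows "averages_converge f (\<lambda>x. c * v x)"
proof -
  have "l1_dist (cesaro n (\<lambda>x. c * v x)) (\<lambda>x. (\<integral>y. c * v y \<partial>lebesgue) * f x) =
     \<bar>c\<bar> * l1_dist (cesaro n v) (\<lambda>x. (\<integral>y. v y \<partial>lebesgue) * f x)" for n
    unfolding l1_dist_scale[symmetric] by (simp add: l1_dist_def cesaro_scale mult.assoc)
  then show ?thesis
    using tendsto_mult_left[OF assms[unfolded averages_converge_def], of "\<bar>c\<bar>"]
    by (simp add: averages_converge_def)
qed

lemma averages_converge_add:
  assumes "averages_converge f u" "averages_converge f v" and L: "unit_L1 u" "unit_L1 v"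
  shows "averages_converge f (\<lambda>x. u x + v x)"
  unfolding averages_converge_def
proof (rule tendsto_sandwich[of "\<lambda>_. 0"])
  let ?lim = "\<lambda>v x. (\<integral>y. v y \<partial>lebesgue) * f x"
  have "?lim (\<lambda>x. u x + v x) = (\<lambda>x. ?lim u x + ?lim v x)"
    using L by (subst Bochner_Integration.integral_add) (auto simp: distrib_right)
  then show "\<forall>\<^sub>F n in sequentially. l1_dist (cesaro n (\<lambda>x. u x + v x)) (?lim (\<lambda>x. u x + v x)) \<le>
      l1_dist (cesaro n u) (?lim u) + l1_dist (cesaro n v) (?lim v)"
    using L f_unit_L1 by (simp add: cesaro_add[abs_def] l1_dist_add_le unit_L1_cesaro unit_L1_scale)
  show "(\<lambda>n. l1_dist (cesaro n u) (?lim u) + l1_dist (cesaro n v) (?lim v)) \<longlonglongrightarrow> 0"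
    using tendsto_add[OF assms(1,2)[unfolded averages_converge_def]] by simp
qed (auto simp: l1_dist_nonneg)

text \<open>Averaging is a contraction, so the functions with convergent averages form a closed set.\<close>

lemma averages_converge_limit:
  assumes v: "unit_L1 v" and w: "\<And>k. averages_converge f (w k)" "\<And>k. unit_L1 (w k)"
    and lim: "(\<lambda>k. l1_dist v (w k)) \<longlonglongrightarrow> 0"
  shows "averages_converge f v"
  unfolding averages_converge_def
proof (rule LIMSEQ_I)
  let ?lim = "\<lambda>v x. (\<integral>y. v y \<partial>lebesgue) * f x"
  fix e :: real assume e: "0 < e"
  have "\<forall>\<^sub>F k in sequentially. l1_dist v (w k) < e / 3"
    using order_tendstoD(2)[OF lim, of "e / 3"] e by simp
  then obtain k where k: "l1_dist v (w k) < e / 3" by (auto simp: eventually_sequentially)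
  have "\<forall>\<^sub>F n in sequentially. l1_dist (cesaro n (w k)) (?lim (w k)) < e / 3"
    using order_tendstoD(2)[OF w(1)[of k, unfolded averages_converge_def], of "e / 3"] e by simp
  then have "\<forall>\<^sub>F n in sequentially. norm (l1_dist (cesaro n v) (?lim v) - 0) < e"
  proof eventually_elim
    case (elim n)
    have L: "unit_L1 (?lim u)" for u by (rule unit_L1_scale[OF f_unit_L1])
    have "l1_dist (?lim (w k)) (?lim v) = \<bar>(\<integral>y. w k y \<partial>lebesgue) - (\<integral>y. v y \<partial>lebesgue)\<bar> * (\<integral>x. \<bar>f x\<bar> \<partial>lebesgue)"
      by (simp add: l1_dist_def abs_mult flip: left_diff_distrib)
    also have "(\<integral>x. \<bar>f x\<bar> \<partial>lebesgue) = 1" using f(3) decreasing_profileD(1)[OF f(1)] by simp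
    finally have 1: "l1_dist (?lim (w k)) (?lim v) \<le> l1_dist v (w k)"
      using l1_dist_integral[OF w(2) v, of k] by (simp add: l1_dist_commute)
    have "l1_dist (cesaro n v) (?lim v) \<le> l1_dist (cesaro n v) (cesaro n (w k)) + l1_dist (cesaro n (w k)) (?lim v)"
      using v w(2) L by (intro l1_dist_triangle unit_L1_cesaro)
    moreover have "l1_dist (cesaro n (w k)) (?lim v) \<le> l1_dist (cesaro n (w k)) (?lim (w k)) + l1_dist (?lim (w k)) (?lim v)"
      using v w(2) L by (intro l1_dist_triangle unit_L1_cesaro)
    moreover have "l1_dist (cesaro n v) (cesaro n (w k)) \<le> l1_dist v (w k)"
      by (rule cesaro_l1_dist[OF v w(2)])
    ultimately have "l1_dist (cesaro n v) (?lim v) < e" using 1 k elim by linarith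
    then show ?case using l1_dist_nonneg[of "cesaro n v" "?lim v"] by simp
  qed
  then show "\<exists>no. \<forall>n\<ge>no. norm (l1_dist (cesaro n v) (?lim v) - 0) < e"
    by (simp add: eventually_sequentially)
qed

text \<open>The normalized indicator of \<open>{0<..<t}\<close> is a bounded decreasing density.\<close>

lemma averages_converge_interval:
  assumes "0 < t" "t \<le> 1" shows "averages_converge f (indicator {0<..<t})"
proof -
  let ?u = "\<lambda>x. 1 / t * indicator {0<..<t} x"
  note u = decreasing_profile_uniform[OF assms]
  have t: "0 \<le> 2 * (2 + 1 / t)" using assms by simp
  have "(\<lambda>n. l1_dist (cesaro n ?u) f) \<longlonglongrightarrow> 0"
    by (rule almost_fixed_convergent[OF decreasing_profile_cesaro[OF u(1)] unit_L1_cesaro[OF u(2)] _ t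
          cesaro_almost_fixed[OF u] f]) (simp only: integral_cesaro[OF u(2)] u(3))
  then have "averages_converge f ?u"
    unfolding averages_converge_def u(3) by simp
  from averages_converge_scale[OF this, of t] show ?thesis
    using assms(1) by simp
qed

lemma averages_converge_0: "averages_converge f (\<lambda>x. 0)"
  using averages_converge_scale[OF averages_converge_interval[of 1], of 0] by simp

text \<open>The intervals \<open>{..<t}\<close> generate the Borel sets and are stable under intersection, and the functions with
convergent averages form a closed linear space: a Dynkin argument applies.\<close>

lemma averages_converge_indicator:
  assumes "A \<in> sets borel" shows "averages_converge f (indicator (A \<inter> {0<..<1}))"
proof -
  have sets: "sets borel = sigma_sets UNIV (range (lessThan :: real \<Rightarrow> real set))"
    by (subst borel_Iio) simp
  have stable: "Int_stable (range (lessThan :: real \<Rightarrow> real set))"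
  proof (rule Int_stableI_image)
    show "\<exists>c\<in>UNIV. {..<a} \<inter> {..<b} = {..<c}" for a b :: real
      by (rule bexI[of _ "min a b"]) auto
  qed
  have sub: "range (lessThan :: real \<Rightarrow> real set) \<subseteq> Pow UNIV" by simp
  have gen: "A \<in> sigma_sets UNIV (range (lessThan :: real \<Rightarrow> real set))"
    using assms sets by simp
  from stable sub gen show ?thesis
  proof (induction rule: sigma_sets_induct_disjoint)
    case (basic A)
    then obtain t :: real where A: "A = {..<t}" by auto
    consider "t \<le> 0" | "0 < t" "t \<le> 1" | "1 < t" by linarith
    then show ?case
    proof cases
      case 1
      then have "A \<inter> {0<..<1} = {}" using A by auto
      then show ?thesis using averages_converge_0 by simp
    next
      case 2
      then have "A \<inter> {0<..<1} = {0<..<t}" using A by auto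
      then show ?thesis using averages_converge_interval[OF 2] by simp
    next
      case 3
      then have "A \<inter> {0<..<1} = {0<..<1}" using A by auto
      then show ?thesis using averages_converge_interval[of 1] by simp
    qed
  next
    case empty
    then show ?case using averages_converge_0 by simp
  next
    case (compl A)
    then have A: "A \<in> sets borel" using sets by simp
    have eq: "indicator ((UNIV - A) \<inter> {0<..<1}) x = indicator (UNIV \<inter> {0<..<1}) x + -1 * (indicator (A \<inter> {0<..<1}) x :: real)" for x :: real
      by (auto simp: indicator_def)
    have "averages_converge f (\<lambda>x. indicator (UNIV \<inter> {0<..<1}) x + -1 * indicator (A \<inter> {0<..<1}) x)"
      using compl(2) averages_converge_interval[of 1] A
      by (intro averages_converge_add averages_converge_scale unit_L1_scale unit_L1_indicator) auto
    then show ?case unfolding eq[abs_def, symmetric] .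
  next
    case (union A)
    then have A: "A i \<in> sets borel" for i using sets by auto
    define w where "w k x = (\<Sum>i<k. indicator (A i \<inter> {0<..<1}) x :: real)" for k x
    have wL: "unit_L1 (w k)" for k
      unfolding w_def[abs_def] by (intro unit_L1_sum unit_L1_indicator A)
    have w: "averages_converge f (w k)" for k
    proof (induction k)
      case 0
      then show ?case using averages_converge_0 by (simp add: w_def[abs_def])
    next
      case (Suc k)
      then show ?case
        using averages_converge_add[OF Suc union(3)[of k] wL unit_L1_indicator[OF A]]
        by (simp add: w_def[abs_def])
    qed
    have w_eq: "w k x = indicator ((\<Union>i<k. A i) \<inter> {0<..<1}) x" for k x
    proof -
      have "disjoint_family_on (\<lambda>i. A i \<inter> {0<..<1}) {..<k}"
        using union(1) by (auto simp: disjoint_family_on_def)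
      then show ?thesis
        unfolding w_def by (subst indicator_UN_disjoint[symmetric]) (auto simp: Int_commute)
    qed
    let ?v = "indicator ((\<Union>i. A i) \<inter> {0<..<1}) :: real \<Rightarrow> real"
    have vL: "unit_L1 ?v" using unit_L1_indicator[of "\<Union>i. A i"] A by auto
    have "(\<lambda>k. \<integral>x. \<bar>?v x - w k x\<bar> \<partial>lebesgue) \<longlonglongrightarrow> integral\<^sup>L lebesgue (\<lambda>x::real. 0 :: real)"
    proof (rule integral_dominated_convergence[where w="indicator (UNIV \<inter> {0<..<1})"])
      show "AE x in lebesgue. (\<lambda>k. \<bar>?v x - w k x\<bar>) \<longlonglongrightarrow> 0"
      proof (rule AE_I2)
        fix x :: real
        show "(\<lambda>k. \<bar>?v x - w k x\<bar>) \<longlonglongrightarrow> 0"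
        proof (cases "x \<in> (\<Union>i. A i)")
          case True
          then obtain i where i: "x \<in> A i" by blast
          have "\<forall>\<^sub>F k in sequentially. \<bar>?v x - w k x\<bar> = 0"
            using eventually_gt_at_top[of i]
            by eventually_elim (use i in \<open>auto simp: w_eq indicator_def\<close>)
          then show ?thesis by (rule tendsto_eventually)
        next
          case False
          then show ?thesis by (auto simp: w_eq indicator_def)
        qed
      qed
      show "integrable lebesgue (indicator (UNIV \<inter> {0<..<1::real}) :: real \<Rightarrow> real)"
        using unit_L1_indicator[of UNIV] by auto
      show "(\<lambda>x. \<bar>?v x - w k x\<bar>) \<in> borel_measurable lebesgue" for k
        using unit_L1_abs[OF unit_L1_diff[OF vL wL[of k]]] by (intro borel_measurable_integrable) auto
      show "AE x in lebesgue. norm \<bar>?v x - w k x\<bar> \<le> indicator (UNIV \<inter> {0<..<1}) x" for k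
        by (rule AE_I2) (auto simp: w_eq indicator_def)
    qed simp
    then have "(\<lambda>k. l1_dist ?v (w k)) \<longlonglongrightarrow> 0" by (simp add: l1_dist_def)
    then show ?case by (rule averages_converge_limit[OF vL w wL])
  qed
qed

lemma averages_converge_borel:
  assumes "integrable lborel v"
  shows "averages_converge f (\<lambda>x. indicator {0<..<1} x * v x) \<and> unit_L1 (\<lambda>x. indicator {0<..<1} x * v x)"
proof
  have L: "unit_L1 (\<lambda>x. indicator {0<..<1} x * v x)" if v: "integrable lborel v" for v :: "real \<Rightarrow> real"
  proof -
    have "integrable lebesgue v" using v by (subst integrable_completion) auto
    then have "integrable lebesgue (\<lambda>x. indicator {0<..<1} x *\<^sub>R v x)"
      by (intro integrable_mult_indicator) auto
    then show ?thesis by (auto simp: unit_L1_def vanishes_outside_def)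
  qed
  show "unit_L1 (\<lambda>x. indicator {0<..<1} x * v x)" by (rule L[OF assms])
  show "averages_converge f (\<lambda>x. indicator {0<..<1} x * v x)"
    using assms
  proof (induction rule: integrable_induct)
    case (base A c)
    have eq: "(\<lambda>x. c * indicator (A \<inter> {0<..<1}) x) = (\<lambda>x. indicator {0<..<1} x * (indicator A x *\<^sub>R c))"
      by (auto simp: indicator_def)
    show ?case
      using averages_converge_scale[OF averages_converge_indicator[of A], of c] base unfolding eq by simp
  next
    case (add u v)
    then show ?case
      using averages_converge_add[OF add(3,4) L L] by (simp add: distrib_left)
  next
    case (lim v w)
    let ?I = "\<lambda>v x. indicator {0<..<1::real} x * (v x :: real)"
    have "(\<lambda>k. \<integral>x. \<bar>?I v x - ?I (w k) x\<bar> \<partial>lebesgue) \<longlonglongrightarrow> integral\<^sup>L lebesgue (\<lambda>x::real. 0 :: real)"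
    proof (rule integral_dominated_convergence[where w="\<lambda>x. 3 * \<bar>?I v x\<bar>"])
      show "AE x in lebesgue. (\<lambda>k. \<bar>?I v x - ?I (w k) x\<bar>) \<longlonglongrightarrow> 0"
      proof (rule AE_I2)
        fix x :: real
        have "(\<lambda>k. ?I v x - ?I (w k) x) \<longlonglongrightarrow> ?I v x - ?I v x"
          using lim.hyps(2)[of x] by (intro tendsto_intros) simp
        then show "(\<lambda>k. \<bar>?I v x - ?I (w k) x\<bar>) \<longlonglongrightarrow> 0" by (intro tendsto_rabs_zero) simp
      qed
      show "integrable lebesgue (\<lambda>x. 3 * \<bar>?I v x\<bar>)"
        by (intro unit_L1_integrable unit_L1_scale unit_L1_abs L lim.hyps)
      show "(\<lambda>x. \<bar>?I v x - ?I (w k) x\<bar>) \<in> borel_measurable lebesgue" for k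
        by (intro borel_measurable_integrable unit_L1_integrable unit_L1_abs unit_L1_diff L lim.hyps)
      show "AE x in lebesgue. norm \<bar>?I v x - ?I (w k) x\<bar> \<le> 3 * \<bar>?I v x\<bar>" for k
      proof (rule AE_I2)
        fix x :: real
        have "\<bar>w k x\<bar> \<le> 2 * \<bar>v x\<bar>" using lim.hyps(3)[of x k] by simp
        then have "\<bar>v x - w k x\<bar> \<le> 3 * \<bar>v x\<bar>" by linarith
        then show "norm \<bar>?I v x - ?I (w k) x\<bar> \<le> 3 * \<bar>?I v x\<bar>"
          by (cases "x \<in> {0<..<1}") auto
      qed
    qed simp
    then have "(\<lambda>k. l1_dist (?I v) (?I (w k))) \<longlonglongrightarrow> 0" by (simp add: l1_dist_def)
    then show ?case
      by (rule averages_converge_limit[where w="\<lambda>k. ?I (w k)", OF L[OF lim.hyps(4)] lim.IH L[OF lim.hyps(1)]])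
  qed
qed

text \<open>A fixed function equals its own averages, which converge to \<open>f\<close>. This removes the monotonicity
assumption from the uniqueness theorem.\<close>

theorem transfer_fixed_unique:
  assumes v: "v \<in> borel_measurable borel" "transfer_fixed v" "(\<integral>x. v x \<partial>lebesgue) = 1"
  shows "l1_dist v f = 0"
proof -
  have vL: "unit_L1 v" using v(2) by (simp add: transfer_fixed_def)
  then have "integrable lborel v"
    using v(1) integrable_completion[of v lborel] by simp
  from averages_converge_borel[OF this] have "averages_converge f (\<lambda>x. indicator {0<..<1} x * v x)" by blast
  moreover have "indicator {0<..<1} x * v x = v x" for x
    using unit_L1_vanishes[OF vL, of x] by (cases "x \<in> {0<..<1}") auto
  ultimately have lim: "(\<lambda>n. l1_dist (cesaro n v) f) \<longlonglongrightarrow> 0"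
    using v(3) by (simp add: averages_converge_def)
  have "l1_dist v f \<le> l1_dist (cesaro n v) f" for n
    using l1_dist_triangle[OF vL unit_L1_cesaro[OF vL] f_unit_L1, of n] cesaro_fixed[OF v(2), of n]
    by (simp add: l1_dist_commute)
  then have "l1_dist v f \<le> 0" using LIMSEQ_le_const[OF lim] by blast
  then show ?thesis using l1_dist_nonneg[of v f] by simp
qed

end

end

section \<open>Invariant densities as fixed points\<close>

lemma intermittent_map_measurable:
  assumes g: "right_branch g"
  shows "(\<lambda>x. indicator {0..1} x * intermittent_map a g x) \<in> borel_measurable borel"
proof -
  have "continuous_on {1/2..1} g"
    using expanding_on_right_branch[OF g] by (simp add: expanding_on_def)
  then have m: "(\<lambda>x. indicator {1/2..1} x * g x) \<in> borel_measurable borel"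
    using borel_measurable_continuous_on_indicator[of "{1/2..1}" g] by simp
  have eq: "(\<lambda>x. indicator {0..1} x * intermittent_map a g x) =
      (\<lambda>x. indicator {0..<1/2} x * (x * (1 + 2 powr a * x powr a)) + indicator {1/2..1} x * g x)"
    by (auto simp: intermittent_map_def indicator_def)
  show ?thesis unfolding eq by (intro borel_measurable_add m) measurable
qed

lemma intermittent_map_vimage:
  assumes g: "right_branch g" and B: "B \<in> sets borel"
  shows "intermittent_map a g -` B \<inter> {0..1} \<in> sets borel"
proof -
  have "(\<lambda>x. indicator {0..1} x * intermittent_map a g x) -` B \<inter> space borel \<in> sets borel"
    by (rule measurable_sets[OF intermittent_map_measurable[OF g] B])
  then have "((\<lambda>x. indicator {0..1} x * intermittent_map a g x) -` B) \<inter> {0..1} \<in> sets borel" by auto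
  also have "((\<lambda>x. indicator {0..1} x * intermittent_map a g x) -` B) \<inter> {0..1} = intermittent_map a g -` B \<inter> {0..1}"
    by (auto simp: indicator_def)
  finally show ?thesis .
qed

lemma sets_unit_interval_iff: "A \<in> sets unit_interval \<longleftrightarrow> A \<in> sets borel \<and> A \<subseteq> {0..1}"
  by (auto simp: sets_restrict_space_iff)

text \<open>The end points form a null set. Removing them makes every density a function to which the
transfer operator applies.\<close>

definition cut_off :: "(real \<Rightarrow> real) \<Rightarrow> real \<Rightarrow> real" where
  "cut_off f x = indicator {0<..<1} x * f x"

text \<open>Integrals with respect to a probability measure given by a density on the unit interval, rewritten
as Lebesgue integrals on the line.\<close>

lemma density_unit_interval:
  assumes f: "f \<in> borel_measurable unit_interval" "AE x in unit_interval. 0 \<le> f x"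
    and prob: "prob_space (density unit_interval (\<lambda>x. ennreal (f x)))"
  shows "cut_off f \<in> borel_measurable borel" "unit_L1 (cut_off f)" "(\<integral>x. cut_off f x \<partial>lebesgue) = 1"
    and "AE x in lebesgue. 0 \<le> cut_off f x"
    and "\<And>p A. p \<in> borel_measurable unit_interval \<Longrightarrow> (\<And>x. x \<in> {0..1} \<Longrightarrow> 0 \<le> p x \<and> p x \<le> 1) \<Longrightarrow>
      A \<in> sets unit_interval \<Longrightarrow>
      (\<integral>\<^sup>+x\<in>A. ennreal (p x) \<partial>(density unit_interval (\<lambda>x. ennreal (f x)))) =
       ennreal (\<integral>x. indicator A x * (p x * cut_off f x) \<partial>lebesgue)"
proof -
  have m0: "(\<lambda>x. indicator {0..1} x * f x) \<in> borel_measurable borel"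
    using f(1) borel_measurable_restrict_space_iff[of "{0..1}" lborel f] by simp
  have "(\<lambda>x. indicator {0<..<1} x * (indicator {0..1} x * f x)) \<in> borel_measurable borel"
    by (intro borel_measurable_times[OF _ m0] borel_measurable_indicator) simp
  also have "(\<lambda>x. indicator {0<..<1} x * (indicator {0..1} x * f x)) = cut_off f"
    by (auto simp: cut_off_def indicator_def)
  finally show m: "cut_off f \<in> borel_measurable borel" .
  then have ml: "cut_off f \<in> borel_measurable lebesgue" by (intro measurable_completion) simp
  have "AE x in lborel. x \<in> {0..1} \<longrightarrow> 0 \<le> f x"
    using f(2) by (subst (asm) AE_restrict_space_iff) auto
  then have "AE x in lborel. 0 \<le> cut_off f x"
    by eventually_elim (auto simp: cut_off_def indicator_def)
  then show nn: "AE x in lebesgue. 0 \<le> cut_off f x" by (rule AE_completion)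
  have ae_ends: "AE x in lborel. x \<noteq> 0 \<and> x \<noteq> (1::real)"
    using AE_lborel_singleton[of "0::real"] AE_lborel_singleton[of "1::real"] by eventually_elim simp
  have nn_int: "(\<integral>\<^sup>+x\<in>A. ennreal (p x) \<partial>(density unit_interval (\<lambda>x. ennreal (f x)))) =
       (\<integral>\<^sup>+x. ennreal (indicator A x * (p x * cut_off f x)) \<partial>lebesgue)"
    if p: "p \<in> borel_measurable unit_interval" "\<And>x. x \<in> {0..1} \<Longrightarrow> 0 \<le> p x \<and> p x \<le> 1"
      and A: "A \<in> sets unit_interval" for p A
  proof -
    have "(\<integral>\<^sup>+x\<in>A. ennreal (p x) \<partial>(density unit_interval (\<lambda>x. ennreal (f x)))) =
        (\<integral>\<^sup>+x. ennreal (f x) * (ennreal (p x) * indicator A x) \<partial>unit_interval)"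
      using f(1) p(1) A by (intro nn_integral_density) auto
    also have "\<dots> = (\<integral>\<^sup>+x. ennreal (f x) * (ennreal (p x) * indicator A x) * indicator {0..1} x \<partial>lborel)"
      by (intro nn_integral_restrict_space) auto
    also have "\<dots> = (\<integral>\<^sup>+x. ennreal (indicator A x * (p x * cut_off f x)) \<partial>lborel)"
    proof (rule nn_integral_cong_AE)
      show "AE x in lborel. ennreal (f x) * (ennreal (p x) * indicator A x) * indicator {0..1} x =
          ennreal (indicator A x * (p x * cut_off f x))"
        using ae_ends
      proof eventually_elim
        case (elim x)
        show ?case
        proof (cases "x \<in> A \<and> x \<in> {0<..<1}")
          case True
          then have "0 \<le> p x" using p(2)[of x] by auto
          then show ?thesis
            using True by (simp add: cut_off_def ennreal_mult'' mult.commute)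
        next
          case False
          then show ?thesis using elim A
            by (auto simp: cut_off_def indicator_def sets_unit_interval_iff)
        qed
      qed
    qed
    finally show ?thesis by (simp add: nn_integral_completion)
  qed
  have one: "(\<integral>\<^sup>+x. ennreal (cut_off f x) \<partial>lebesgue) = 1"
  proof -
    let ?\<mu> = "density unit_interval (\<lambda>x. ennreal (f x))"
    have "1 = emeasure ?\<mu> {0..1}"
      using prob_space.emeasure_space_1[OF prob] by (simp add: space_restrict_space)
    also have "\<dots> = (\<integral>\<^sup>+x\<in>{0..1}. ennreal 1 \<partial>?\<mu>)"
      by (subst ennreal_1, subst nn_integral_cmult_indicator) (auto simp: sets_unit_interval_iff)
    also have "\<dots> = (\<integral>\<^sup>+x. ennreal (indicator {0..1} x * (1 * cut_off f x)) \<partial>lebesgue)"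
      by (rule nn_int) (auto simp: sets_unit_interval_iff)
    also have "(\<lambda>x. indicator {0..1} x * (1 * cut_off f x)) = cut_off f"
      by (auto simp: cut_off_def indicator_def)
    finally show ?thesis by (rule sym)
  qed
  have int: "integrable lebesgue (cut_off f)"
    using one nn ml by (intro integrableI_nonneg) auto
  then show L: "unit_L1 (cut_off f)"
    by (auto simp: unit_L1_def vanishes_outside_def cut_off_def)
  show "(\<integral>x. cut_off f x \<partial>lebesgue) = 1"
    using nn_integral_eq_integral[OF int nn] one by simp
  show "(\<integral>\<^sup>+x\<in>A. ennreal (p x) \<partial>(density unit_interval (\<lambda>x. ennreal (f x)))) =
       ennreal (\<integral>x. indicator A x * (p x * cut_off f x) \<partial>lebesgue)"
    if p: "p \<in> borel_measurable unit_interval" "\<And>x. x \<in> {0..1} \<Longrightarrow> 0 \<le> p x \<and> p x \<le> 1"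
      and A: "A \<in> sets unit_interval" for p A
  proof (rule trans[OF nn_int[OF p A] nn_integral_eq_integral])
    show "integrable lebesgue (\<lambda>x. indicator A x * (p x * cut_off f x))"
      using A unit_L1_mult[OF L p] by (intro integrable_indicator_mult) (auto simp: sets_unit_interval_iff)
    show "AE x in lebesgue. 0 \<le> indicator A x * (p x * cut_off f x)"
      using nn
    proof eventually_elim
      case (elim x)
      then show ?case using p(2)[of x] by (cases "x \<in> {0..1}") (auto simp: cut_off_def indicator_def)
    qed
  qed
qed

lemma AE_eq_if_borel_integrals_eq:
  fixes u v :: "real \<Rightarrow> real"
  assumes "integrable lebesgue u" "integrable lebesgue v"
    and eq: "\<And>B. B \<in> sets borel \<Longrightarrow> (\<integral>x. indicator B x * u x \<partial>lebesgue) = (\<integral>x. indicator B x * v x \<partial>lebesgue)"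
  shows "AE x in lebesgue. u x = v x"
proof (rule density_unique_real[OF assms(1,2)])
  fix A :: "real set" assume A: "A \<in> sets lebesgue"
  then obtain B N N' where B: "A = B \<union> N" "N \<subseteq> N'" "N' \<in> null_sets lborel" "B \<in> sets lborel"
    by (rule sets_completionE)
  have "AE x in lborel. x \<notin> N'" using B(3) by (rule AE_not_in)
  then have "AE x in lebesgue. x \<notin> N'" by (rule AE_completion)
  then have ae: "AE x in lebesgue. (indicator A x :: real) = indicator B x"
    by eventually_elim (use B in \<open>auto simp: indicator_def\<close>)
  have "(\<integral>x\<in>A. w x \<partial>lebesgue) = (\<integral>x. indicator B x * w x \<partial>lebesgue)" if "integrable lebesgue w" for w :: "real \<Rightarrow> real"
    unfolding set_lebesgue_integral_def
  proof (rule integral_cong_AE)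
    have "integrable lebesgue (\<lambda>x. indicator A x *\<^sub>R w x)" "integrable lebesgue (\<lambda>x. indicator B x *\<^sub>R w x)"
      using integrable_mult_indicator[OF A that] integrable_mult_indicator[of B lebesgue w] that B(4) by auto
    then show "(\<lambda>x. indicator A x *\<^sub>R w x) \<in> borel_measurable lebesgue" "(\<lambda>x. indicator B x * w x) \<in> borel_measurable lebesgue"
      by (simp_all only: real_scaleR_def borel_measurable_integrable)
    show "AE x in lebesgue. indicator A x *\<^sub>R w x = indicator B x * w x"
      using ae by eventually_elim simp
  qed
  then show "(\<integral>x\<in>A. u x \<partial>lebesgue) = (\<integral>x\<in>A. v x \<partial>lebesgue)"
    using assms(1,2) eq[of B] B(4) by simp
qed

context random_map
begin

text \<open>Invariance states that the density and its image under the operator have the same integral over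
every Borel set, by duality.\<close>

lemma invariant_density_fixed:
  assumes f: "invariant_density (random_invariant T S p q) f"
  shows "transfer_fixed (cut_off f)"
proof -
  let ?\<mu> = "density unit_interval (\<lambda>x. ennreal (f x))"
  have f': "f \<in> borel_measurable unit_interval" "AE x in unit_interval. 0 \<le> f x" "prob_space ?\<mu>"
    and inv: "\<And>B. B \<in> sets unit_interval \<Longrightarrow> emeasure ?\<mu> B =
        (\<integral>\<^sup>+x\<in>T -` B \<inter> {0..1}. ennreal (p x) \<partial>?\<mu>) + (\<integral>\<^sup>+x\<in>S -` B \<inter> {0..1}. ennreal (q x) \<partial>?\<mu>)"
    using f by (auto simp: invariant_density_def random_invariant_def)
  note D = density_unit_interval[OF f']
  let ?u = "cut_off f"
  have L: "unit_L1 ?u" by (rule D(2))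
  have range: "R y \<in> {0..1}" if "y \<in> {0..1}" "R = T \<or> R = S" for R y
  proof -
    have "intermittent_map a k y \<in> {0..1}" if "0 < a" "right_branch k" for a k
    proof (cases "y < 1/2")
      case True
      then show ?thesis
        using expanding_on_less[OF expanding_on_left_branch[OF that(1)], of 0 y]
          expanding_on_less[OF expanding_on_left_branch[OF that(1)], of y "1/2"] \<open>y \<in> {0..1}\<close>
        by (cases "y = 0") (auto simp: intermittent_map_left)
    next
      case False
      then show ?thesis using that(2) \<open>y \<in> {0..1}\<close>
        by (auto simp: intermittent_map_right right_branch_def Pi_iff)
    qed
    then show ?thesis using \<open>R = T \<or> R = S\<close> alpha_pos exponents right_branches by auto
  qed
  have "(\<integral>x. indicator B x * ?u x \<partial>lebesgue) = (\<integral>x. indicator B x * transfer ?u x \<partial>lebesgue)"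
    if B: "B \<in> sets borel" for B
  proof -
    let ?B = "B \<inter> {0..1}"
    have BU: "?B \<in> sets unit_interval" using B by (auto simp: sets_unit_interval_iff)
    have vT: "T -` ?B \<inter> {0..1} \<in> sets unit_interval" "S -` ?B \<inter> {0..1} \<in> sets unit_interval"
      using intermittent_map_vimage[OF right_branches(1), of ?B] intermittent_map_vimage[OF right_branches(2), of ?B] B
      by (auto simp: sets_unit_interval_iff)
    have "emeasure ?\<mu> ?B = (\<integral>\<^sup>+x\<in>?B. ennreal 1 \<partial>?\<mu>)"
      by (subst ennreal_1, subst nn_integral_cmult_indicator) (use BU in auto)
    also have "\<dots> = ennreal (\<integral>x. indicator ?B x * (1 * ?u x) \<partial>lebesgue)"
      by (rule D(5)) (use BU in auto)
    also have "(\<lambda>x. indicator ?B x * (1 * ?u x)) = (\<lambda>x. indicator B x * ?u x)"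
      by (auto simp: indicator_def cut_off_def)
    finally have 1: "emeasure ?\<mu> ?B = ennreal (\<integral>x. indicator B x * ?u x \<partial>lebesgue)" .
    have 2: "(\<integral>\<^sup>+x\<in>T -` ?B \<inter> {0..1}. ennreal (p x) \<partial>?\<mu>) = ennreal (\<integral>x. indicator B (T x) * (p x * ?u x) \<partial>lebesgue)"
    proof -
      have "(\<integral>\<^sup>+x\<in>T -` ?B \<inter> {0..1}. ennreal (p x) \<partial>?\<mu>) =
          ennreal (\<integral>x. indicator (T -` ?B \<inter> {0..1}) x * (p x * ?u x) \<partial>lebesgue)"
        by (rule D(5)[OF pq_measurable(1) _ vT(1)]) (use pq in blast)
      also have "(\<lambda>x. indicator (T -` ?B \<inter> {0..1}) x * (p x * ?u x)) = (\<lambda>x. indicator B (T x) * (p x * ?u x))"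
      proof
        show "indicator (T -` ?B \<inter> {0..1}) x * (p x * ?u x) = indicator B (T x) * (p x * ?u x)" for x
          using range[of x T] by (cases "x \<in> {0..1}") (auto simp: indicator_def cut_off_def)
      qed
      finally show ?thesis .
    qed
    have 3: "(\<integral>\<^sup>+x\<in>S -` ?B \<inter> {0..1}. ennreal (q x) \<partial>?\<mu>) = ennreal (\<integral>x. indicator B (S x) * (q x * ?u x) \<partial>lebesgue)"
    proof -
      have "(\<integral>\<^sup>+x\<in>S -` ?B \<inter> {0..1}. ennreal (q x) \<partial>?\<mu>) =
          ennreal (\<integral>x. indicator (S -` ?B \<inter> {0..1}) x * (q x * ?u x) \<partial>lebesgue)"
        by (rule D(5)[OF pq_measurable(2) _ vT(2)]) (use pq in blast)
      also have "(\<lambda>x. indicator (S -` ?B \<inter> {0..1}) x * (q x * ?u x)) = (\<lambda>x. indicator B (S x) * (q x * ?u x))"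
      proof
        show "indicator (S -` ?B \<inter> {0..1}) x * (q x * ?u x) = indicator B (S x) * (q x * ?u x)" for x
          using range[of x S] by (cases "x \<in> {0..1}") (auto simp: indicator_def cut_off_def)
      qed
      finally show ?thesis .
    qed
    have nn: "0 \<le> (\<integral>x. w x * (r x * ?u x) \<partial>lebesgue)" if "\<And>x. x \<in> {0..1} \<Longrightarrow> 0 \<le> r x" "\<And>x. 0 \<le> w x" for w r :: "real \<Rightarrow> real"
    proof (rule integral_nonneg_AE)
      show "AE x in lebesgue. 0 \<le> w x * (r x * ?u x)"
        using D(4)
      proof eventually_elim
        case (elim x)
        then show ?case using that(1)[of x] that(2)[of x] by (cases "x \<in> {0..1}") (auto simp: cut_off_def)
      qed
    qed
    have nnp: "0 \<le> (\<integral>x. indicator B (T x) * (p x * ?u x) \<partial>lebesgue)" "0 \<le> (\<integral>x. indicator B (S x) * (q x * ?u x) \<partial>lebesgue)"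
      by (rule nn; use pq in simp)+
    have nn1: "0 \<le> (\<integral>x. indicator B x * ?u x \<partial>lebesgue)"
      using nn[of "\<lambda>_. 1" "indicator B"] by simp
    have "ennreal (\<integral>x. indicator B x * ?u x \<partial>lebesgue) = ennreal ((\<integral>x. indicator B (T x) * (p x * ?u x) \<partial>lebesgue)
        + (\<integral>x. indicator B (S x) * (q x * ?u x) \<partial>lebesgue))"
      using inv[OF BU] unfolding 1 2 3 using nnp by (simp add: ennreal_plus)
    then have "(\<integral>x. indicator B x * ?u x \<partial>lebesgue) = (\<integral>x. indicator B (T x) * (p x * ?u x) \<partial>lebesgue)
        + (\<integral>x. indicator B (S x) * (q x * ?u x) \<partial>lebesgue)"
      using nn1 nnp by (subst (asm) ennreal_inj) auto
    then show ?thesis using transfer_duality(3)[OF L B] by simp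
  qed
  then have "AE x in lebesgue. ?u x = transfer ?u x"
    using L by (intro AE_eq_if_borel_integrals_eq) auto
  then have "AE x in lebesgue. transfer ?u x = ?u x" by eventually_elim simp
  then show ?thesis using L by (simp add: transfer_fixed_def)
qed

text \<open>Every invariant density has a decreasing version, with a bound that is the same for all random maps
with first exponent \<open>\<alpha>\<close>.\<close>

theorem invariant_density_decreasing:
  assumes f: "invariant_density (random_invariant T S p q) f"
  obtains h where "decreasing_profile h" "transfer_fixed h" "(\<integral>x. h x \<partial>lebesgue) = 1"
    "\<And>x. x \<in> {0<..<1} \<Longrightarrow> h x \<le> 4 * x powr - \<alpha>" "l1_dist (cut_off f) h = 0"
proof -
  obtain h where h: "decreasing_profile h" "transfer_fixed h" "(\<integral>x. h x \<partial>lebesgue) = 1"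
    "\<And>x. x \<in> {0<..<1} \<Longrightarrow> h x \<le> 4 * x powr - \<alpha>"
    using decreasing_transfer_fixed_exists by blast
  have "f \<in> borel_measurable unit_interval" "AE x in unit_interval. 0 \<le> f x"
    "prob_space (density unit_interval (\<lambda>x. ennreal (f x)))"
    using f by (auto simp: invariant_density_def)
  note D = density_unit_interval[OF this]
  have "l1_dist (cut_off f) h = 0"
    by (rule transfer_fixed_unique[OF h(1-3) D(1) invariant_density_fixed[OF f] D(3)])
  with h show ?thesis using that by blast
qed

end

section \<open>The unperturbed map as a limit of random maps\<close>

lemma map_invariant_imp_random_invariant:
  assumes g: "right_branch g" and inv: "map_invariant (intermittent_map a g) \<mu>"
  shows "random_invariant (intermittent_map a g) (intermittent_map a g) (\<lambda>_. 1) (\<lambda>_. 0) \<mu>"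
proof -
  let ?T = "intermittent_map a g"
  have sets: "sets \<mu> = sets unit_interval" using inv by (simp add: map_invariant_def)
  have "emeasure \<mu> B = (\<integral>\<^sup>+x\<in>?T -` B \<inter> {0..1}. ennreal 1 \<partial>\<mu>) + (\<integral>\<^sup>+x\<in>?T -` B \<inter> {0..1}. ennreal 0 \<partial>\<mu>)"
    if B: "B \<in> sets unit_interval" for B
  proof -
    have "?T -` B \<inter> {0..1} \<in> sets \<mu>"
      using intermittent_map_vimage[OF g, of B a] B by (simp add: sets sets_unit_interval_iff)
    then have "(\<integral>\<^sup>+x\<in>?T -` B \<inter> {0..1}. ennreal 1 \<partial>\<mu>) = emeasure \<mu> (?T -` B \<inter> {0..1})"
      by (subst ennreal_1, subst nn_integral_cmult_indicator) simp_all
    then show ?thesis using inv B by (simp add: map_invariant_def)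
  qed
  then show ?thesis using sets by (simp add: random_invariant_def)
qed

text \<open>The weight depends on the numerator only through its value at one preimage.\<close>

lemma branch_weight_tendsto:
  assumes inj: "inj_on T (branch_dom i)" and "\<And>y. y \<in> {0..1} \<Longrightarrow> ((\<lambda>e. p e y) \<longlongrightarrow> r y) F"
  shows "((\<lambda>e. branch_weight T (p e) i x) \<longlongrightarrow> branch_weight T r i x) F"
proof (cases "x \<in> T ` branch_dom i")
  case True
  have "the_inv_into (branch_dom i) T x \<in> branch_dom i"
    by (rule the_inv_into_into[OF inj True order_refl])
  then have "the_inv_into (branch_dom i) T x \<in> {0..1}" by (auto simp: branch_dom_def split: if_splits)
  from assms(2)[OF this] show ?thesis
    using True by (simp add: branch_weight_def Let_def divide_inverse tendsto_mult_right)
qed (simp add: branch_weight_def)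

lemma antimono_on_limit:
  fixes w :: "'a \<Rightarrow> real \<Rightarrow> real"
  assumes "F \<noteq> bot" "\<forall>\<^sub>F e in F. antimono_on A (w e)" "\<And>x. x \<in> A \<Longrightarrow> ((\<lambda>e. w e x) \<longlongrightarrow> v x) F"
  shows "antimono_on A v"
proof (rule monotone_onI)
  fix x y assume xy: "x \<in> A" "y \<in> A" "x \<le> y"
  have "\<forall>\<^sub>F e in F. w e y \<le> w e x"
    using assms(2) by eventually_elim (use xy in \<open>auto simp: monotone_on_def\<close>)
  then show "v y \<le> v x" by (rule tendsto_le[OF assms(1) assms(3)[OF xy(1)] assms(3)[OF xy(2)]])
qed

text \<open>The unperturbed map inherits the monotonicity of its weights from the perturbed ones, since
pointwise limits of decreasing functions are decreasing.\<close>

lemma cond_A_unperturbed: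
  assumes ag: "0 < a" "right_branch g" and F: "F \<noteq> bot"
    and A: "\<forall>\<^sub>F e in F. cond_A (intermittent_map a g) (S e) (p e) (q e)"
    and p: "\<And>y. y \<in> {0..1} \<Longrightarrow> ((\<lambda>e. p e y) \<longlongrightarrow> 1) F"
  shows "cond_A (intermittent_map a g) (intermittent_map a g) (\<lambda>_. 1) (\<lambda>_. 0)"
  unfolding cond_A_def
proof (intro ballI conjI)
  fix l :: nat assume l: "l \<in> {1, 2}"
  let ?T = "intermittent_map a g"
  show "antimono_on {0..<1} (\<lambda>x. \<Sum>i=1..l. branch_weight ?T (\<lambda>_. 1) i x)"
  proof (rule antimono_on_limit[OF F])
    show "\<forall>\<^sub>F e in F. antimono_on {0..<1} (\<lambda>x. \<Sum>i=1..l. branch_weight ?T (p e) i x)"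
      using A by eventually_elim (use l in \<open>unfold cond_A_def, blast\<close>)
    show "((\<lambda>e. \<Sum>i=1..l. branch_weight ?T (p e) i x) \<longlongrightarrow> (\<Sum>i=1..l. branch_weight ?T (\<lambda>_. 1) i x)) F" for x
      by (intro tendsto_sum branch_weight_tendsto inj_on_intermittent_map[OF ag] p)
  qed
  show "antimono_on {0..<1} (\<lambda>x. \<Sum>i=1..l. branch_weight ?T (\<lambda>_. 0) i x)"
  proof -
    have "branch_weight ?T (\<lambda>_. 0) i x = 0" for i x by (simp add: branch_weight_def)
    then show ?thesis by (simp add: monotone_on_def)
  qed
qed

text \<open>Since \<open>1 - p = q\<close>, the two images of \<open>h\<close> differ by the image of \<open>q * h\<close> under \<open>T\<close> minus its image under
\<open>S\<close>, and each of these has mass \<open>\<integral> q * h \<le> s * \<integral> h\<close>.\<close>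

lemma transfer_perturbation:
  assumes R: "random_map \<alpha> \<beta> g g' p q" and D: "random_map \<alpha> \<alpha> g g (\<lambda>_. 1) (\<lambda>_. 0)"
    and h: "\<And>x. 0 \<le> h x" "unit_L1 h" and s: "\<And>x. x \<in> {0..1} \<Longrightarrow> q x \<le> s"
  shows "l1_dist (random_map.transfer \<alpha> \<alpha> g g (\<lambda>_. 1) (\<lambda>_. 0) h) (random_map.transfer \<alpha> \<beta> g g' p q h)
    \<le> 2 * s * (\<integral>x. h x \<partial>lebesgue)"
proof -
  interpret R: random_map \<alpha> \<beta> g g' p q by (rule R)
  interpret D: random_map \<alpha> \<alpha> g g "\<lambda>_. 1" "\<lambda>_. 0" by (rule D)
  let ?u = "\<lambda>x. q x * h x"
  have u: "unit_L1 ?u" by (rule R.unit_L1_q[OF h(2)])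
  have u0: "0 \<le> ?u x" "?u 1 = 0" for x
    using h(1)[of x] unit_L1_vanishes[OF h(2), of x] unit_L1_vanishes[OF h(2), of 1] R.pq[of x]
    by (cases "x \<in> {0..1}"; auto)+
  have MT: "unit_L1 (map_transfer R.T ?u)" "unit_L1 (map_transfer R.S ?u)"
    using R.alpha_pos R.exponents R.right_branches u by (auto intro: unit_L1_map_transfer)
  have nn: "0 \<le> map_transfer R.T ?u x" "0 \<le> map_transfer R.S ?u x" for x
    by (rule map_transfer_nonneg; use u0 R.alpha_pos R.exponents R.right_branches in blast)+
  have int: "(\<integral>x. map_transfer R.T ?u x \<partial>lebesgue) = (\<integral>x. ?u x \<partial>lebesgue)"
    "(\<integral>x. map_transfer R.S ?u x \<partial>lebesgue) = (\<integral>x. ?u x \<partial>lebesgue)"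
    using map_transfer_duality(3)[OF R.alpha_pos R.right_branches(1), of ?u UNIV]
      map_transfer_duality(3)[OF R.exponents(1) R.right_branches(2), of ?u UNIV] u
    by (auto simp: unit_L1_def)
  have diff: "D.transfer h x - R.transfer h x = map_transfer R.T ?u x - map_transfer R.S ?u x" for x
  proof -
    have "(\<lambda>y. p y * h y) = (\<lambda>y. h y - ?u y)"
    proof
      show "p y * h y = h y - ?u y" for y
      proof (cases "y \<in> {0..1}")
        case True
        then have "p y = 1 - q y" using R.pq[of y] by simp
        show ?thesis unfolding \<open>p y = 1 - q y\<close> by (simp add: left_diff_distrib)
      qed (use unit_L1_vanishes[OF h(2), of y] in auto)
    qed
    then have "map_transfer R.T (\<lambda>y. p y * h y) x = map_transfer R.T h x - map_transfer R.T ?u x"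
      by (simp only: map_transfer_diff)
    moreover have "map_transfer R.T (\<lambda>y. 0 * h y) x = 0"
      using map_transfer_scale[of R.T 0 h x] by simp
    ultimately show ?thesis by (simp add: D.transfer_def R.transfer_def)
  qed
  have "l1_dist (D.transfer h) (R.transfer h) \<le> (\<integral>x. map_transfer R.T ?u x + map_transfer R.S ?u x \<partial>lebesgue)"
    unfolding l1_dist_def diff
  proof (rule integral_mono)
    show "\<bar>map_transfer R.T ?u x - map_transfer R.S ?u x\<bar> \<le> map_transfer R.T ?u x + map_transfer R.S ?u x" for x
      using nn[of x] by (simp add: abs_le_iff)
  qed (intro unit_L1_integrable unit_L1_abs unit_L1_diff unit_L1_add MT)+
  also have "\<dots> = 2 * (\<integral>x. ?u x \<partial>lebesgue)"
    using MT int by (subst Bochner_Integration.integral_add) auto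
  also have "(\<integral>x. ?u x \<partial>lebesgue) \<le> (\<integral>x. s * h x \<partial>lebesgue)"
  proof (rule integral_mono)
    show "?u x \<le> s * h x" for x
      using s[of x] h(1)[of x] unit_L1_vanishes[OF h(2), of x]
      by (cases "x \<in> {0..1}") (auto intro: mult_right_mono)
  qed (use u h(2) in auto)
  finally show ?thesis by simp
qed

lemma integral_unit_interval_l1_dist:
  assumes "f \<in> borel_measurable unit_interval" "k \<in> borel_measurable unit_interval"
    and L: "unit_L1 (cut_off f)" "unit_L1 (cut_off k)"
  shows "(LINT x|unit_interval. \<bar>f x - k x\<bar>) = l1_dist (cut_off f) (cut_off k)"
proof -
  have m: "(\<lambda>x. indicator {0..1} x *\<^sub>R \<bar>f x - k x\<bar>) \<in> borel_measurable lborel"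
    using assms(1,2) by (subst borel_measurable_restrict_space_iff[symmetric]) auto
  have "(LINT x|unit_interval. \<bar>f x - k x\<bar>) = (\<integral>x. indicator {0..1} x *\<^sub>R \<bar>f x - k x\<bar> \<partial>lborel)"
    by (rule integral_restrict_space) simp
  also have "\<dots> = (\<integral>x. indicator {0..1} x *\<^sub>R \<bar>f x - k x\<bar> \<partial>lebesgue)"
    by (rule integral_completion[OF m, symmetric])
  also have "\<dots> = l1_dist (cut_off f) (cut_off k)"
    unfolding l1_dist_def
  proof (rule integral_cong_AE)
    have "AE x in lborel. x \<noteq> 0 \<and> x \<noteq> (1::real)"
      using AE_lborel_singleton[of "0::real"] AE_lborel_singleton[of "1::real"] by eventually_elim simp
    then have "AE x in lebesgue. x \<noteq> 0 \<and> x \<noteq> (1::real)" by (rule AE_completion)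
    then show "AE x in lebesgue. indicator {0..1} x *\<^sub>R \<bar>f x - k x\<bar> = \<bar>cut_off f x - cut_off k x\<bar>"
      by eventually_elim (auto simp: cut_off_def indicator_def)
    show "(\<lambda>x. indicator {0..1} x *\<^sub>R \<bar>f x - k x\<bar>) \<in> borel_measurable lebesgue"
      by (rule measurable_completion[OF m])
    show "(\<lambda>x. \<bar>cut_off f x - cut_off k x\<bar>) \<in> borel_measurable lebesgue"
      using unit_L1_abs[OF unit_L1_diff[OF L]] by (intro borel_measurable_integrable) auto
  qed
  finally show ?thesis .
qed

lemma invariant_density_cut_off:
  assumes "invariant_density P f"
  shows "f \<in> borel_measurable unit_interval" "unit_L1 (cut_off f)"
  using assms density_unit_interval(2)[of f] by (auto simp: invariant_density_def)

section \<open>Stability of the invariant density\<close>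

theorem theorem6p1:
  fixes \<alpha> :: real
    and g1 :: "real \<Rightarrow> real" and g1\<epsilon> :: "real \<Rightarrow> real \<Rightarrow> real"
    and p1 p2 :: "real \<Rightarrow> real \<Rightarrow> real"
    and f :: "real \<Rightarrow> real \<Rightarrow> real" and fstar :: "real \<Rightarrow> real"
  assumes \<alpha>: "0 < \<alpha>" "\<alpha> < 1"
    and g1: "right_branch g1"
    and g1\<epsilon>: "\<And>\<epsilon>. 0 < \<epsilon> \<Longrightarrow> \<epsilon> < \<alpha> \<Longrightarrow> right_branch (g1\<epsilon> \<epsilon>)"
    and probs: "\<And>\<epsilon>. 0 < \<epsilon> \<Longrightarrow> \<epsilon> < \<alpha> \<Longrightarrow> position_probs (p1 \<epsilon>) (p2 \<epsilon>)"
    and A: "\<And>\<epsilon>. 0 < \<epsilon> \<Longrightarrow> \<epsilon> < \<alpha> \<Longrightarrow> cond_A (intermittent_map \<alpha> g1) (intermittent_map (\<alpha> - \<epsilon>) (g1\<epsilon> \<epsilon>))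
              (p1 \<epsilon>) (p2 \<epsilon>)"
    and B: "\<And>\<epsilon>. 0 < \<epsilon> \<Longrightarrow> \<epsilon> < \<alpha> \<Longrightarrow> cond_B (p1 \<epsilon>) (p2 \<epsilon>)"
    and f: "\<And>\<epsilon>. 0 < \<epsilon> \<Longrightarrow> \<epsilon> < \<alpha> \<Longrightarrow>
              invariant_density
                (random_invariant (intermittent_map \<alpha> g1) (intermittent_map (\<alpha> - \<epsilon>) (g1\<epsilon> \<epsilon>))
                  (p1 \<epsilon>) (p2 \<epsilon>)) (f \<epsilon>)"
    and fstar: "invariant_density (map_invariant (intermittent_map \<alpha> g1)) fstar"
    and lim: "((\<lambda>\<epsilon>. SUP x\<in>{0..1}. p2 \<epsilon> x) \<longlongrightarrow> 0) (at_right 0)"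
  shows "((\<lambda>\<epsilon>. LINT x|unit_interval. \<bar>f \<epsilon> x - fstar x\<bar>) \<longlongrightarrow> 0) (at_right 0)"
proof -
  let ?sup = "\<lambda>\<epsilon>. SUP x\<in>{0..1}. p2 \<epsilon> x"
  have small: "\<forall>\<^sub>F \<epsilon> in at_right 0. 0 < \<epsilon> \<and> \<epsilon> < \<alpha>"
    using \<alpha>(1) by (auto simp: eventually_at_right intro: exI[of _ \<alpha>])
  have pq: "0 \<le> p1 \<epsilon> x" "0 \<le> p2 \<epsilon> x" "p2 \<epsilon> x \<le> 1" "p1 \<epsilon> x + p2 \<epsilon> x = 1" if "0 < \<epsilon>" "\<epsilon> < \<alpha>" "x \<in> {0..1}" for \<epsilon> x
    using probs[OF that(1,2)] that(3) by (auto simp: position_probs_def)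
  have sup: "p2 \<epsilon> x \<le> ?sup \<epsilon>" if "0 < \<epsilon>" "\<epsilon> < \<alpha>" "x \<in> {0..1}" for \<epsilon> x
    using pq(3)[OF that(1,2)] that(3) by (intro cSUP_upper bdd_aboveI2[where M=1]) auto
  have p1_lim: "((\<lambda>\<epsilon>. p1 \<epsilon> y) \<longlongrightarrow> 1) (at_right 0)" if y: "y \<in> {0..1}" for y
  proof (rule tendsto_sandwich)
    show "\<forall>\<^sub>F \<epsilon> in at_right 0. 1 - ?sup \<epsilon> \<le> p1 \<epsilon> y" 
      using small
    proof eventually_elim
      case (elim \<epsilon>)
      then show ?case using pq(4)[of \<epsilon> y] sup[of \<epsilon> y] y by linarith
    qed
    show "\<forall>\<^sub>F \<epsilon> in at_right 0. p1 \<epsilon> y \<le> 1"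
      using small
    proof eventually_elim
      case (elim \<epsilon>)
      then show ?case using pq(2,4)[of \<epsilon> y] y by linarith
    qed
    show "((\<lambda>\<epsilon>. 1 - ?sup \<epsilon>) \<longlongrightarrow> 1) (at_right 0)"
      using tendsto_diff[OF tendsto_const lim, of 1] by simp
  qed simp
  (* Condition B is what makes the first probability positive. *)
  have R: "random_map \<alpha> (\<alpha> - \<epsilon>) g1 (g1\<epsilon> \<epsilon>) (p1 \<epsilon>) (p2 \<epsilon>)" if \<epsilon>: "0 < \<epsilon>" "\<epsilon> < \<alpha>" for \<epsilon>
  proof
    fix x :: real assume x: "x \<in> {0..1}"
    obtain \<delta> where \<delta>: "\<delta> > 0" "\<delta> \<le> (INF x\<in>{0..1}. p1 \<epsilon> x)" using B[OF \<epsilon>] by (auto simp: cond_B_def)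
    have "(INF x\<in>{0..1}. p1 \<epsilon> x) \<le> p1 \<epsilon> x"
      using pq(1)[OF \<epsilon>] x by (intro cINF_lower bdd_belowI2[where m=0]) auto
    then show "0 < p1 \<epsilon> x" using \<delta> by linarith
  qed (use \<alpha> g1 g1\<epsilon> probs A \<epsilon> in auto)
  have "\<forall>\<^sub>F \<epsilon> in at_right 0. cond_A (intermittent_map \<alpha> g1) (intermittent_map (\<alpha> - \<epsilon>) (g1\<epsilon> \<epsilon>)) (p1 \<epsilon>) (p2 \<epsilon>)"
    using small by eventually_elim (use A in blast)
  then have "cond_A (intermittent_map \<alpha> g1) (intermittent_map \<alpha> g1) (\<lambda>_. 1) (\<lambda>_. 0)"
    by (rule cond_A_unperturbed[OF \<alpha>(1) g1 trivial_limit_at_right_real _ p1_lim])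
  then interpret D: random_map \<alpha> \<alpha> g1 g1 "\<lambda>_. 1" "\<lambda>_. 0"
    using \<alpha> g1 by unfold_locales (auto simp: position_probs_def)
  have fstar': "invariant_density (random_invariant D.T D.T (\<lambda>_. 1) (\<lambda>_. 0)) fstar"
    using fstar map_invariant_imp_random_invariant[OF g1] by (auto simp: invariant_density_def)
  obtain h where h: "decreasing_profile h" "D.transfer_fixed h" "(\<integral>x. h x \<partial>lebesgue) = 1"
    "\<And>x. x \<in> {0<..<1} \<Longrightarrow> h x \<le> 4 * x powr - \<alpha>" "l1_dist (cut_off fstar) h = 0"
    using D.invariant_density_decreasing[OF fstar'] by blast
  have hL: "unit_L1 h" using h(2) by (simp add: D.transfer_fixed_def)
  note star = invariant_density_cut_off[OF fstar]
  show ?thesis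
    unfolding tendsto_at_iff_sequentially
  proof (intro allI impI)
    fix X :: "nat \<Rightarrow> real" assume X: "\<forall>i. X i \<in> {0<..} - {0}" "X \<longlonglongrightarrow> 0"
    have X_small: "\<forall>\<^sub>F n in sequentially. X n < \<alpha>" using order_tendstoD(2)[OF X(2) \<alpha>(1)] .
    have X_sup: "(\<lambda>n. ?sup (X n)) \<longlonglongrightarrow> 0"
      using lim X unfolding tendsto_at_iff_sequentially by (auto simp: o_def)
    (* For the finitely many n with X n outside the parameter range, the limit density h serves as
       a default value. *)
    have "\<exists>k. decreasing_profile k \<and> unit_L1 k \<and> (\<integral>x. k x \<partial>lebesgue) = 1 \<and>
        (\<forall>x\<in>{0<..<1}. k x \<le> 4 * x powr - \<alpha>) \<and>
        (X n < \<alpha> \<longrightarrow> l1_dist (cut_off (f (X n))) k = 0 \<and> l1_dist (D.transfer k) k \<le> 2 * ?sup (X n))" for n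
    proof (cases "X n < \<alpha>")
      case False
      then show ?thesis using h hL by blast
    next
      case True
      have \<epsilon>: "0 < X n" using X(1) by auto
      interpret R: random_map \<alpha> "\<alpha> - X n" g1 "g1\<epsilon> (X n)" "p1 (X n)" "p2 (X n)"
        by (rule R[OF \<epsilon> True])
      obtain k where k: "decreasing_profile k" "R.transfer_fixed k" "(\<integral>x. k x \<partial>lebesgue) = 1"
        "\<And>x. x \<in> {0<..<1} \<Longrightarrow> k x \<le> 4 * x powr - \<alpha>" "l1_dist (cut_off (f (X n))) k = 0"
        using R.invariant_density_decreasing[OF f[OF \<epsilon> True]] by blast
      have kL: "unit_L1 k" using k(2) by (simp add: R.transfer_fixed_def)
      have "l1_dist (D.transfer k) k \<le> l1_dist (D.transfer k) (R.transfer k) + l1_dist (R.transfer k) k"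
        using kL by (intro l1_dist_triangle) auto
      also have "l1_dist (R.transfer k) k = 0" using k(2) kL by (simp add: R.transfer_fixed_iff)
      also have "l1_dist (D.transfer k) (R.transfer k) \<le> 2 * ?sup (X n)"
        using transfer_perturbation[OF R.random_map_axioms D.random_map_axioms decreasing_profileD(1)[OF k(1)] kL
            sup[OF \<epsilon> True]] k(3) by simp
      finally show ?thesis using k kL by auto
    qed
    then obtain k where k: "\<And>n. decreasing_profile (k n)" "\<And>n. unit_L1 (k n)" "\<And>n. (\<integral>x. k n x \<partial>lebesgue) = 1"
        "\<And>n x. x \<in> {0<..<1} \<Longrightarrow> k n x \<le> 4 * x powr - \<alpha>"
        "\<And>n. X n < \<alpha> \<Longrightarrow> l1_dist (cut_off (f (X n))) (k n) = 0"
        "\<And>n. X n < \<alpha> \<Longrightarrow> l1_dist (D.transfer (k n)) (k n) \<le> 2 * ?sup (X n)"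
      by metis
    have "(\<lambda>n. l1_dist (D.transfer (k n)) (k n)) \<longlonglongrightarrow> 0"
    proof (rule tendsto_sandwich[of "\<lambda>_. 0"])
      show "\<forall>\<^sub>F n in sequentially. l1_dist (D.transfer (k n)) (k n) \<le> 2 * ?sup (X n)"
        using X_small by eventually_elim (rule k(6))
      show "(\<lambda>n. 2 * ?sup (X n)) \<longlonglongrightarrow> 0" using tendsto_mult_left[OF X_sup, of 2] by simp
    qed (auto simp: l1_dist_nonneg)
    from D.almost_fixed_convergent[OF k(1-3) _ k(4) this h(1-3)]
    have kh: "(\<lambda>n. l1_dist (k n) h) \<longlonglongrightarrow> 0" by simp
    have "\<forall>\<^sub>F n in sequentially. (LINT x|unit_interval. \<bar>f (X n) x - fstar x\<bar>) \<le> l1_dist (k n) h"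
      using X_small
    proof eventually_elim
      case (elim n)
      have \<epsilon>: "0 < X n" using X(1) by auto
      note fn = invariant_density_cut_off[OF f[OF \<epsilon> elim]]
      have "(LINT x|unit_interval. \<bar>f (X n) x - fstar x\<bar>) = l1_dist (cut_off (f (X n))) (cut_off fstar)"
        by (rule integral_unit_interval_l1_dist[OF fn(1) star(1) fn(2) star(2)])
      also have "\<dots> \<le> l1_dist (cut_off (f (X n))) (k n) + l1_dist (k n) (cut_off fstar)"
        by (rule l1_dist_triangle[OF fn(2) k(2) star(2)])
      also have "l1_dist (k n) (cut_off fstar) \<le> l1_dist (k n) h + l1_dist h (cut_off fstar)"
        by (rule l1_dist_triangle[OF k(2) hL star(2)])
      finally show ?case using k(5)[OF elim] h(5) by (simp add: l1_dist_commute)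
    qed
    then show "((\<lambda>\<epsilon>. LINT x|unit_interval. \<bar>f \<epsilon> x - fstar x\<bar>) \<circ> X) \<longlonglongrightarrow> 0"
      unfolding o_def by (intro tendsto_sandwich[OF _ _ tendsto_const kh]) auto
  qed
qed

end
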